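(* Let $U(t,t_0)$ ($t,t_0>0$) be a family of symplectic transformations of $\mathcal P$ that are block diagonal with blocks $$U_m(t,t_0)=\begin{pmatrix}\mathcal U_m&0\\0&\mathcal U_m\end{pmatrix},\quad \mathcal U_m=\begin{pmatrix}\alpha_m(t,t_0)&\beta_m(t,t_0)\\ \beta_m^*(t,t_0)&\alpha_m^*(t,t_0)\end{pmatrix},\quad |\alpha_m|^2-|\beta_m|^2=1,\quad m\in\mathbb N.$$ Assume: (i) (Condition 1) there exist $t_0>0$ and $\delta\in(0,\pi)$ such that for every measurable set $\widetilde E_\delta\subset[0,\pi]$ with Lebesgue measure $\mu(\widetilde E_\delta)>\pi-\delta$ there is a constant $\Delta(\widetilde E_\delta)>0$ with $$\int_{\widetilde E_\delta}\left\{1-(\mathrm{Re}[\alpha_m(t_0+\tau,t_0)])^2\right\}d\tau>\Delta(\widetilde E_\delta)\qquad\forall m\in\mathbb N;$$ (ii) for this value of $t_0$ and every $m\in\mathbb N$, the functions $\tau\mapsto\alpha_m(t_0+\tau,t_0)$ and $\tau\mapsto\beta_m(t_0+\tau,t_0)$ are measurable on $[0,\pi]$; (iii) $U(t,t_0)$ is unitarily implementable with respect to $J_0$ for all $t,t_0>0$ (equivalently $\sum_{m}|\beta_m(t,t_0)|^2<\infty$ for all $t,t_0>0$). Let $J$ be a compatible complex structure on $\mathcal P$, invariant under all $S^1$-translations, such that $U(t,t_0)$ is unitarily implementable with respect to $J$ for all $t,t_0>0$. Let $K_J$ be a symplectic transformation with $J=K_JJ_0K_J^{-1}$, block diagonal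 with $4\times 4$ blocks $$(K_J)_m=\begin{pmatrix}\mathcal K_m&0\\0&\mathcal K_m\end{pmatrix},\quad \mathcal K_m=\begin{pmatrix}\kappa_m&\lambda_m\\ \lambda_m^*&\kappa_m^*\end{pmatrix},\quad|\kappa_m|^2-|\lambda_m|^2=1.$$ Then $\sum_{m=1}^\infty|\lambda_m|^2$ is finite.
   Context: Phase space (zero mode removed). $\mathcal P$ is the real vector space of pairs $(\xi,P)$ of smooth real functions on $S^1=\mathbb R/2\pi\mathbb Z$ with zero mean, with symplectic form $\Omega((\xi_1,P_1),(\xi_2,P_2))=\oint(\xi_2P_1-\xi_1P_2)\,d\theta$. Write $\xi=\sum_{n\ne0}\xi_n e^{in\theta}/\sqrt{2\pi}$, $P=\sum_{n\neq 0} P^n e^{in\theta}/\sqrt{2\pi}$ and, for $m\in\mathbb N=\{1,2,\dots\}$, $b_m=(m\xi_m+iP^m)/\sqrt{2m}$, $b_{-m}^*=(m\xi_m-iP^m)/\sqrt{2m}$ ($*$ is complex conjugation; $b_m^*$, $b_{-m}$ are the conjugates). Put $B_m=(b_m,b_{-m}^*,b_{-m},b_m^* )^T$. A real-linear map $A$ of $\mathcal P$ is block diagonal with $4\times4$ blocks $A_m$ if it acts by $B_m\mapsto A_mB_m$ for all $m$. Translations: $T_\alpha$ ($\alpha\in S^1$) acts by $b_m\mapsto e^{im\alpha}b_m$, $b_{-m}^*\mapsto e^{im\alpha}b_{-m}^*$, $b_{-m}\mapsto e^{-im\alpha}b_{-m}$, $b_m^*\mapsto e^{-im\alpha}b_m^*$.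 A complex structure $J$ is invariant if $T_\alpha^{-1}JT_\alpha=J$ for all $\alpha\in S^1$. Complex structures: a compatible complex structure is a real-linear map $J:\mathcal P\to\mathcal P$ with $J^2=-\mathbf 1$, which is symplectic and such that $\Omega(J\cdot,\cdot)$ is positive definite. It gives the inner product $\langle\cdot,\cdot\rangle_J=\{\Omega(J\cdot,\cdot)-i\Omega(\cdot,\cdot)\}/2$. A real-linear map of $\mathcal P$ is Hilbert-Schmidt with respect to $\langle\cdot,\cdot\rangle_J$ if it extends to a Hilbert-Schmidt (real-linear) operator on the completion of $\mathcal P$. The reference structure $J_0$ is block diagonal with $(J_0)_m=\mathrm{diag}(i,-i,i,-i)$. A symplectic transformation $A$ is unitarily implementable with respect to $J$ iff $(A+JAJ)/2$ is Hilbert-Schmidt with respect to $\langle\cdot,\cdot\rangle_J$ (standard criterion, taken as definition). With $J=K_JJ_0K_J^{-1}$ as in the claim, unitary implementability of $U(t,t_0)$ with respect to $J$ is equivalent to $\sum_{m}|\beta^J_m(t,t_0)|^2<\infty$, where $\beta^J_m=2i\,\mathrm{Im}[\alpha_m]\kappa_m^*\lambda_m+(\kappa_m^* )^2\beta_m-\lambda_m^2\beta_m^*$ (all functions evaluated at $(t,t_0)$). *)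

theory Defs
  imports "HOL-Analysis.Analysis"
begin

section \<open>Smooth functions of zero mean on the circle\<close>

definition smooth :: "(real \<Rightarrow> real) \<Rightarrow> bool" where
  "smooth f \<longleftrightarrow> (\<forall>n x. ((deriv ^^ n) f) differentiable (at x))"

lemma smooth_differentiable: "smooth f \<Longrightarrow> f differentiable (at x)"
  unfolding smooth_def by (metis funpow_0)

lemma smooth_deriv: "smooth f \<Longrightarrow> smooth (deriv f)"
  unfolding smooth_def
proof (intro allI)
  fix n x assume *: "\<forall>n x. (deriv ^^ n) f differentiable at x"
  show "(deriv ^^ n) (deriv f) differentiable at x"
    using *[rule_format, of "Suc n" x] by (simp only: funpow_Suc_right o_apply)
qed

lemma smooth_DERIV: "smooth f \<Longrightarrow> (f has_real_derivative deriv f x) (at x)"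
  using smooth_differentiable[of f x] DERIV_deriv_iff_real_differentiable by blast

lemma smooth_isCont: "smooth f \<Longrightarrow> isCont f x"
  using smooth_DERIV DERIV_isCont by blast

lemma smooth_continuous_on: "smooth f \<Longrightarrow> continuous_on A f"
  using smooth_isCont continuous_at_imp_continuous_on by blast

lemma smooth_coinduct:
  assumes "P f" and step: "\<And>g. P g \<Longrightarrow> \<exists>g'. P g' \<and> (\<forall>x. (g has_real_derivative g' x) (at x))"
  shows "smooth f"
proof -
  have "P ((deriv ^^ n) f)" for n
  proof (induction n)
    case 0 then show ?case using assms by simp
  next
    case (Suc n)
    obtain g' where g': "P g'" "\<forall>x. (((deriv ^^ n) f) has_real_derivative g' x) (at x)"
      using step[OF Suc] by blast
    have "deriv ((deriv ^^ n) f) = g'" using g'(2) DERIV_imp_deriv by blast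
    then show ?case using g' by simp
  qed
  then show ?thesis unfolding smooth_def using step real_differentiable_def by blast
qed

lemma smooth_zero: "smooth (\<lambda>_. 0)"
  by (rule smooth_coinduct[where P = "\<lambda>g. g = (\<lambda>_. 0)"]) auto

lemma smooth_add: "smooth f \<Longrightarrow> smooth g \<Longrightarrow> smooth (\<lambda>x. f x + g x)"
  apply (rule smooth_coinduct[where P = "\<lambda>h. \<exists>f g. smooth f \<and> smooth g \<and> h = (\<lambda>x. f x + g x)"])
   apply blast
  by (metis (mono_tags, lifting) DERIV_add smooth_DERIV smooth_deriv)

lemma smooth_scale: "smooth f \<Longrightarrow> smooth (\<lambda>x. c * f x)"
  apply (rule smooth_coinduct[where P = "\<lambda>h. \<exists>f. smooth f \<and> h = (\<lambda>x. c * f x)"])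
   apply blast
  by (metis (mono_tags, lifting) DERIV_cmult smooth_DERIV smooth_deriv)

lemma smooth_shift: "smooth f \<Longrightarrow> smooth (\<lambda>x. f (x + a))"
  apply (rule smooth_coinduct[where P = "\<lambda>h. \<exists>f. smooth f \<and> h = (\<lambda>x. f (x + a))"])
   apply blast
  by (metis (mono_tags, lifting) DERIV_shift smooth_DERIV smooth_deriv)

lemma integral_period_shift:
  fixes f :: "real \<Rightarrow> 'b::euclidean_space"
  assumes c: "continuous_on UNIV f" and p: "\<And>x. f (x + 2 * pi) = f x"
  shows "integral {0..2*pi} (\<lambda>x. f (x + a)) = integral {0..2*pi} f"
proof -
  have int: "f integrable_on {u..v}" for u v
    using c continuous_on_subset integrable_continuous_real by blast
  define F where "F = (\<lambda>a. integral {0..2*pi} (\<lambda>x. f (x + a)))"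
  have sh: "integral {u..v} (\<lambda>x. f (x + a)) = integral {u + a..v + a} f" for u v a
  proof -
    have "((\<lambda>x. f (1 *\<^sub>R x + a)) has_integral (1 / \<bar>1\<bar>) *\<^sub>R integral {u + a..v + a} f)
        ((\<lambda>x. (1 / 1) *\<^sub>R x + - ((1 / 1) *\<^sub>R a)) ` cbox (u + a) (v + a))"
      using has_integral_affinity[of f "integral {u + a..v + a} f" "u + a" "v + a" 1 a] int
      by (simp add: integrable_integral)
    moreover have "(\<lambda>x. (1 / 1) *\<^sub>R x + - ((1 / 1) *\<^sub>R a)) ` cbox (u + a) (v + a) = {u..v}"
      by (auto simp: image_iff intro!: bexI[where x = "_ + a"])
    ultimately show ?thesis by (simp add: integral_unique)
  qed
  have small: "integral {0..2*pi} (\<lambda>x. f (x + a)) = integral {0..2*pi} f"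
    if "0 \<le> a" for a :: real
  proof -
    have "integral {0..2*pi} f + integral {2*pi..2*pi+a} f = integral {0..2*pi+a} f"
      by (rule Henstock_Kurzweil_Integration.integral_combine) (use that int in auto)
    moreover have "integral {0..a} f + integral {a..2*pi+a} f = integral {0..2*pi+a} f"
      by (rule Henstock_Kurzweil_Integration.integral_combine) (use that int in auto)
    moreover have "integral {2*pi..2*pi+a} f = integral {0..a} f"
      using sh[of 0 a "2*pi"] p by (simp add: add.commute)
    moreover have "integral {0..2*pi} (\<lambda>x. f (x + a)) = integral {a..2*pi+a} f"
      using sh[of 0 "2*pi" a] by simp
    ultimately show ?thesis by (metis add.commute add_left_cancel)
  qed
  show ?thesis
  proof (cases "0 \<le> a")
    case True then show ?thesis using small by blast
  next
    case False
    define g where "g = (\<lambda>x. f (x + a))"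
    obtain n :: nat where n: "- a \<le> real n * (2 * pi)"
      by (metis reals_Archimedean3 less_eq_real_def pi_gt_zero mult_pos_pos zero_less_numeral)
    have per: "f (x + real n * (2 * pi)) = f x" for x n
    proof (induction n arbitrary: x)
      case (Suc n)
      have "f (x + real (Suc n) * (2 * pi)) = f ((x + real n * (2 * pi)) + 2 * pi)"
        by (simp add: algebra_simps)
      then show ?case using p Suc by simp
    qed simp
    have "integral {0..2*pi} (\<lambda>x. f (x + (a + real n * (2*pi)))) = integral {0..2*pi} f"
      by (rule small) (use n in simp)
    moreover have "f (x + (a + real n * (2*pi))) = f (x + a)" for x
      using per[of "x + a" n] by (simp add: add.assoc)
    ultimately show ?thesis by simp
  qed
qed

typedef circle_fun = "{f :: real \<Rightarrow> real. smooth f \<and> (\<forall>\<theta>. f (\<theta> + 2 * pi) = f \<theta>) \<and>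
    integral {0..2 * pi} f = 0}"
  morphisms apply_cf Abs_cf
  by (rule exI[where x = "\<lambda>_. 0"]) (simp add: smooth_zero)

setup_lifting type_definition_circle_fun

instantiation circle_fun :: real_vector
begin

lift_definition zero_circle_fun :: circle_fun is "\<lambda>_. 0"
  by (simp add: smooth_zero)

lift_definition plus_circle_fun :: "circle_fun \<Rightarrow> circle_fun \<Rightarrow> circle_fun" is
  "\<lambda>f g \<theta>. f \<theta> + g \<theta>"
  by (auto simp: smooth_add Henstock_Kurzweil_Integration.integral_add
      integrable_continuous_real smooth_continuous_on)

lift_definition scaleR_circle_fun :: "real \<Rightarrow> circle_fun \<Rightarrow> circle_fun" is
  "\<lambda>c f \<theta>. c * f \<theta>"
  by (auto simp: smooth_scale)

definition uminus_circle_fun :: "circle_fun \<Rightarrow> circle_fun" where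
  "uminus_circle_fun f = (-1) *\<^sub>R f"

definition minus_circle_fun :: "circle_fun \<Rightarrow> circle_fun \<Rightarrow> circle_fun" where
  "minus_circle_fun f g = f + (-1) *\<^sub>R g"

instance
  by standard (unfold uminus_circle_fun_def minus_circle_fun_def, (transfer; auto simp: algebra_simps)+)

end

lift_definition shift :: "real \<Rightarrow> circle_fun \<Rightarrow> circle_fun" is "\<lambda>\<alpha> f \<theta>. f (\<theta> + \<alpha>)"
  by (auto simp: smooth_shift integral_period_shift smooth_continuous_on)
     (metis add.assoc add.commute)


section \<open>Fourier coefficients\<close>

definition fourier :: "(real \<Rightarrow> real) \<Rightarrow> int \<Rightarrow> complex" where
  "fourier f n = integral {0..2 * pi} (\<lambda>\<theta>. complex_of_real (f \<theta>) * cis (- (of_int n * \<theta>))) / sqrt (2 * pi)"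

lemma fourier_integrable:
  assumes "continuous_on UNIV f"
  shows "(\<lambda>\<theta>. complex_of_real (f \<theta>) * cis (- (of_int n * \<theta>))) integrable_on {0..2 * pi}"
  by (rule integrable_continuous_real)
     (auto simp: cis_conv_exp intro!: continuous_intros intro: continuous_on_subset[OF assms])

lemma fourier_add:
  assumes "continuous_on UNIV f" "continuous_on UNIV g"
  shows "fourier (\<lambda>\<theta>. f \<theta> + g \<theta>) n = fourier f n + fourier g n"
  unfolding fourier_def
  using Henstock_Kurzweil_Integration.integral_add[OF fourier_integrable[OF assms(1), of n] fourier_integrable[OF assms(2), of n]]
  by (simp add: distrib_right add_divide_distrib)

lemma fourier_scale: "fourier (\<lambda>\<theta>. c * f \<theta>) n = c * fourier f n"
  unfolding fourier_def by (simp add: mult.assoc)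

lemma cis_2pi_int: "cis (x + of_int n * (2 * pi)) = cis x"
  by (metis cis_multiple_2pi cis_mult Ints_of_int mult.commute mult.right_neutral mult.assoc)

lemma cis_has_vector_derivative:
  "((\<lambda>\<theta>. cis (c * \<theta>)) has_vector_derivative \<i> * of_real c * cis (c * x)) (at x within A)"
proof -
  have "((\<lambda>z. exp (\<i> * of_real c * z)) has_field_derivative \<i> * of_real c * exp (\<i> * of_real c * of_real x)) (at (of_real x))"
    by (auto intro!: derivative_eq_intros)
  then have "((\<lambda>\<theta>. exp (\<i> * of_real c * of_real \<theta>)) has_vector_derivative \<i> * of_real c * exp (\<i> * of_real c * of_real x)) (at x within A)"
    by (rule has_vector_derivative_real_field)
  then show ?thesis by (simp add: cis_conv_exp mult.assoc)
qed

lemma fourier_shift: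
  assumes c: "continuous_on UNIV f" and p: "\<And>x. f (x + 2 * pi) = f x"
  shows "fourier (\<lambda>\<theta>. f (\<theta> + a)) n = cis (of_int n * a) * fourier f n"
proof -
  let ?h = "\<lambda>\<theta>. complex_of_real (f \<theta>) * cis (- (of_int n * \<theta>))"
  have c': "continuous_on UNIV ?h"
    by (auto simp: cis_conv_exp intro!: continuous_intros c)
  have "cis (- (of_int n * (x + 2 * pi))) = cis (- (of_int n * x))" for x
    using cis_2pi_int[of "- (of_int n * x)" "- n"] by (simp add: algebra_simps)
  then have "?h (x + 2 * pi) = ?h x" for x
    by (simp only: p)
  then have "integral {0..2*pi} (\<lambda>x. ?h (x + a)) = integral {0..2*pi} ?h"
    using c' by (intro integral_period_shift)
  moreover have "complex_of_real (f (x + a)) * cis (- (of_int n * x)) = cis (of_int n * a) * ?h (x + a)" for x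
    by (simp add: mult.left_commute[of "cis _"] cis_mult) (simp add: algebra_simps)
  then have "(\<lambda>x. complex_of_real (f (x + a)) * cis (- (of_int n * x))) = (\<lambda>x. cis (of_int n * a) * ?h (x + a))"
    by (rule ext)
  ultimately show ?thesis unfolding fourier_def
    by (simp only: Henstock_Kurzweil_Integration.integral_mult_right times_divide_eq_right)
qed

lemma fourier_deriv:
  assumes f: "smooth f" and p: "\<And>x. f (x + 2 * pi) = f x"
  shows "fourier (deriv f) n = \<i> * of_int n * fourier f n"
proof -
  let ?e = "\<lambda>\<theta>. cis (- (of_int n * \<theta>))"
  let ?h = "\<lambda>\<theta>. complex_of_real (f \<theta>) * ?e \<theta>"
  let ?h' = "\<lambda>\<theta>. complex_of_real (deriv f \<theta>) * ?e \<theta> - \<i> * of_int n * (complex_of_real (f \<theta>) * ?e \<theta>)"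
  have e: "(?e has_vector_derivative (- \<i> * of_int n * ?e x)) (at x within A)" for x A
    using cis_has_vector_derivative[of "- of_int n" x A] by simp
  have d: "((\<lambda>\<theta>. complex_of_real (f \<theta>)) has_vector_derivative complex_of_real (deriv f x)) (at x within A)" for x A
    using smooth_DERIV[OF f] has_field_derivative_at_within has_vector_derivative_of_real
      has_real_derivative_iff_has_vector_derivative by blast
  have "(?h has_vector_derivative ?h' x) (at x within {0..2*pi})" for x
    using has_vector_derivative_mult[OF d e] by (simp add: algebra_simps)
  then have "(?h' has_integral (?h (2*pi) - ?h 0)) {0..2*pi}"
    by (intro fundamental_theorem_of_calculus) auto
  moreover have "?h (2*pi) = ?h 0"
    using p[of 0] cis_2pi_int[of 0 "- n"] by simp
  ultimately have "integral {0..2*pi} ?h' = 0" by (simp add: integral_unique)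
  moreover have "integral {0..2*pi} ?h' = integral {0..2*pi} (\<lambda>\<theta>. complex_of_real (deriv f \<theta>) * ?e \<theta>)
      - \<i> * of_int n * integral {0..2*pi} ?h"
    using Henstock_Kurzweil_Integration.integral_diff[OF
        fourier_integrable[OF smooth_continuous_on[OF smooth_deriv[OF f]], of n]
        integrable_on_mult_right[OF fourier_integrable[OF smooth_continuous_on[OF f], of n], of "\<i> * of_int n"]]
    by simp
  ultimately show ?thesis unfolding fourier_def by simp
qed

lemma deriv_periodic:
  assumes f: "smooth f" and p: "\<And>x. f (x + 2 * pi) = f x"
  shows "deriv f (x + 2 * pi) = deriv f x"
proof -
  have "((\<lambda>x. f (x + 2 * pi)) has_real_derivative deriv f (x + 2 * pi)) (at x)"
    using smooth_DERIV[OF f] DERIV_shift by blast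
  moreover have "(\<lambda>x. f (x + 2 * pi)) = f" using p by (rule ext)
  ultimately show ?thesis using DERIV_imp_deriv by metis
qed

lemma fourier_bounded:
  assumes f: "continuous_on UNIV f"
  shows "\<exists>C. \<forall>n. norm (fourier f n) \<le> C"
proof -
  have "compact (f ` {0..2*pi})"
    using f by (intro compact_continuous_image) (auto intro: continuous_on_subset)
  then obtain M where M: "\<And>x. x \<in> {0..2*pi} \<Longrightarrow> \<bar>f x\<bar> \<le> M"
    using compact_imp_bounded bounded_iff by (metis imageI real_norm_def)
  have "norm (integral {0..2*pi} (\<lambda>\<theta>. complex_of_real (f \<theta>) * cis (- (of_int n * \<theta>)))) \<le> M * (2 * pi - 0)" for n
    by (rule integral_bound)
       (auto simp: norm_mult M cis_conv_exp intro!: continuous_intros intro: continuous_on_subset[OF f])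
  then have "norm (fourier f n) \<le> M * (2 * pi) / sqrt (2 * pi)" for n
    unfolding fourier_def by (simp add: norm_divide divide_right_mono)
  then show ?thesis by blast
qed

lemma fourier_decay:
  assumes "smooth f" "\<And>x. f (x + 2 * pi) = f x"
  shows "\<exists>C. \<forall>n. \<bar>of_int n\<bar> ^ k * norm (fourier f n) \<le> C"
  using assms
proof (induction k arbitrary: f)
  case 0
  then show ?case using fourier_bounded smooth_continuous_on by simp
next
  case (Suc k)
  then have "\<exists>C. \<forall>n. \<bar>of_int n\<bar> ^ k * norm (fourier (deriv f) n) \<le> C"
    using smooth_deriv deriv_periodic by blast
  then show ?case using Suc.prems by (simp add: fourier_deriv norm_mult mult_ac)
qed

definition rapid :: "(nat \<Rightarrow> complex) \<Rightarrow> bool" where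
  "rapid a \<longleftrightarrow> (\<forall>k. summable (\<lambda>m. real m ^ k * norm (a m)))"

definition trig_series :: "(nat \<Rightarrow> complex) \<Rightarrow> real \<Rightarrow> real" where
  "trig_series a \<theta> = (\<Sum>m. 2 * Re (a m * cis (real m * \<theta>)) / sqrt (2 * pi))"

lemma rapid_I:
  assumes "\<And>k. \<exists>C. \<forall>m. real m ^ k * norm (a m) \<le> C"
  shows "rapid a"
  unfolding rapid_def
proof
  fix k
  obtain C where C: "\<And>m. real m ^ (k + 2) * norm (a m) \<le> C" using assms by blast
  show "summable (\<lambda>m. real m ^ k * norm (a m))"
  proof (rule summable_comparison_test)
    show "summable (\<lambda>m. C * (1 / real m ^ 2))"
      using inverse_power_summable[of 2, where 'a = real]
      by (intro summable_mult) (simp add: field_simps)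
    show "\<exists>N. \<forall>n\<ge>N. norm (real n ^ k * norm (a n)) \<le> C * (1 / real n ^ 2)"
    proof (intro exI[of _ 1] allI impI)
      fix n :: nat assume "1 \<le> n"
      then show "norm (real n ^ k * norm (a n)) \<le> C * (1 / real n ^ 2)"
        using C[of n] by (simp add: field_simps power_add norm_mult power2_eq_square)
    qed
  qed
qed

lemma rapid_mult:
  assumes "rapid a" "\<And>m. norm (c m) \<le> real m ^ d"
  shows "rapid (\<lambda>m. c m * a m)"
  unfolding rapid_def
proof
  fix k
  have "summable (\<lambda>m. real m ^ (k + d) * norm (a m))" using assms unfolding rapid_def by blast
  then show "summable (\<lambda>m. real m ^ k * norm (c m * a m))"
    by (rule summable_comparison_test[rotated])
       (auto simp: norm_mult power_add mult.assoc intro!: mult_left_mono mult_right_mono assms)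
qed

lemma rapid_summable:
  assumes "rapid a" shows "summable (\<lambda>m. norm (a m))"
  using assms unfolding rapid_def by (metis (no_types, lifting) ext mult_1 power_0)

lemma trig_term_bound: "norm (2 * Re (a * cis t) / sqrt (2 * pi)) \<le> 2 * norm a"
proof -
  have "\<bar>Re (a * cis t)\<bar> \<le> norm a" using abs_Re_le_cmod[of "a * cis t"] by (simp add: norm_mult)
  moreover have "1 \<le> sqrt (2 * pi)" using pi_ge_two by simp
  moreover have "2 * norm a \<le> 2 * norm a * sqrt (2 * pi)"
    using calculation(2) by (simp add: mult_le_cancel_left1)
  ultimately show ?thesis by (simp add: abs_mult divide_le_eq)
qed

lemma trig_term_summable:
  assumes "rapid a"
  shows "summable (\<lambda>m. 2 * Re (a m * cis (t m)) / sqrt (2 * pi))"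
  by (rule summable_comparison_test'[where g = "\<lambda>m. 2 * norm (a m)" and N = 0],
      rule summable_mult[OF rapid_summable[OF assms]], rule trig_term_bound)

lemma trig_series_uniform:
  assumes "rapid a"
  shows "uniform_limit UNIV (\<lambda>n \<theta>. \<Sum>m<n. 2 * Re (a m * cis (real m * \<theta>)) / sqrt (2 * pi)) (trig_series a) sequentially"
  unfolding trig_series_def
  by (rule Weierstrass_m_test[where M = "\<lambda>m. 2 * norm (a m)"])
     (rule trig_term_bound, rule summable_mult[OF rapid_summable[OF assms]])

lemma trig_series_DERIV:
  assumes a: "rapid a"
  shows "(trig_series a has_real_derivative trig_series (\<lambda>m. \<i> * of_nat m * a m) \<theta>) (at \<theta>)"
proof -
  let ?a' = "\<lambda>m. \<i> * of_nat m * a m"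
  have a': "rapid ?a'" by (rule rapid_mult[OF a, where d = 1]) (simp add: norm_mult)
  show ?thesis unfolding trig_series_def[abs_def]
  proof (rule has_field_derivative_series'(2)[of UNIV])
    fix m x
    have "((\<lambda>\<theta>. a m * cis (real m * \<theta>)) has_vector_derivative ?a' m * cis (real m * x)) (at x)"
      using has_vector_derivative_mult_right[OF cis_has_vector_derivative[of "real m" x UNIV], of "a m"]
      by (simp add: mult_ac)
    then have "((\<lambda>\<theta>. Re (a m * cis (real m * \<theta>))) has_real_derivative Re (?a' m * cis (real m * x))) (at x)"
      using bounded_linear.has_vector_derivative[OF bounded_linear_Re] has_real_derivative_iff_has_vector_derivative
      by blast
    then show "((\<lambda>\<theta>. 2 * Re (a m * cis (real m * \<theta>)) / sqrt (2 * pi)) has_real_derivative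
        2 * Re (?a' m * cis (real m * x)) / sqrt (2 * pi)) (at x within UNIV)"
      by (intro DERIV_cdivide DERIV_cmult)
  next
    show "uniformly_convergent_on UNIV (\<lambda>n x. \<Sum>m<n. 2 * Re (?a' m * cis (real m * x)) / sqrt (2 * pi))"
      using trig_series_uniform[OF a'] uniformly_convergent_on_def by blast
    show "summable (\<lambda>n. 2 * Re (a n * cis (real n * 0)) / sqrt (2 * pi))"
      by (rule trig_term_summable[OF a])
  qed auto
qed

lemma trig_series_smooth: "rapid a \<Longrightarrow> smooth (trig_series a)"
proof (rule smooth_coinduct[where P = "\<lambda>f. \<exists>a. rapid a \<and> f = trig_series a"])
  fix g assume "\<exists>a. rapid a \<and> g = trig_series a"
  then obtain b where b: "rapid b" "g = trig_series b" by blast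
  have "rapid (\<lambda>m. \<i> * of_nat m * b m)"
    by (rule rapid_mult[OF b(1), where d = 1]) (simp add: norm_mult)
  with b trig_series_DERIV[OF b(1)]
  show "\<exists>g'. (\<exists>a. rapid a \<and> g' = trig_series a) \<and> (\<forall>x. (g has_real_derivative g' x) (at x))" by blast
qed blast

lemma integral_cis:
  "integral {0..2 * pi} (\<lambda>\<theta>. cis (of_int k * \<theta>)) = (if k = 0 then 2 * pi else 0)"
proof (cases "k = 0")
  case False
  have "((\<lambda>\<theta>. cis (of_int k * \<theta>)) has_integral
      (cis (of_int k * (2*pi)) / (\<i> * of_int k) - cis (of_int k * 0) / (\<i> * of_int k))) {0..2*pi}"
  proof (rule fundamental_theorem_of_calculus)
    fix x
    show "((\<lambda>\<theta>. cis (of_int k * \<theta>) / (\<i> * of_int k)) has_vector_derivative cis (of_int k * x)) (at x within {0..2*pi})"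
      using has_vector_derivative_divide[OF cis_has_vector_derivative[of "of_int k" x], of "\<i> * of_int k"] False
      by simp
  qed simp
  moreover have "cis (of_int k * (2*pi)) = 1" using cis_2pi_int[of 0 k] by simp
  ultimately show ?thesis using False by (simp add: integral_unique)
qed (simp add: scaleR_conv_of_real)

lemma fourier_trig_series:
  assumes a: "rapid a" and a0: "a 0 = 0"
  shows "fourier (trig_series a) (int n) = a n"
proof -
  let ?e = "\<lambda>\<theta>. cis (- (of_int (int n) * \<theta>))"
  let ?t = "\<lambda>m \<theta>. complex_of_real (2 * Re (a m * cis (real m * \<theta>)) / sqrt (2 * pi)) * ?e \<theta>"
  have tm: "integral {0..2*pi} (?t m) = (if m = n then sqrt (2 * pi) * a n else 0)" (is "?I m = _")
    and intt: "?t m integrable_on {0..2*pi}" for m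
  proof -
    let ?A = "\<lambda>\<theta>. a m / sqrt (2*pi) * cis (of_int (int m - int n) * \<theta>)"
    let ?B = "\<lambda>\<theta>. cnj (a m) / sqrt (2*pi) * cis (of_int (- int m - int n) * \<theta>)"
    have ints: "(\<lambda>\<theta>. cis (of_int k * \<theta>)) integrable_on {0..2*pi}" for k
      by (intro integrable_continuous_real) (auto simp: cis_conv_exp intro!: continuous_intros)
    have eq: "?t m = (\<lambda>\<theta>. ?A \<theta> + ?B \<theta>)"
    proof
      fix \<theta>
      have "complex_of_real (2 * Re (a m * cis (real m * \<theta>))) = a m * cis (real m * \<theta>) + cnj (a m) * cis (- (real m * \<theta>))"
        using complex_add_cnj[of "a m * cis (real m * \<theta>)"] by (simp only: complex_cnj_mult cis_cnj)
      then show "?t m \<theta> = ?A \<theta> + ?B \<theta>"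
        by (simp add: add_divide_distrib distrib_right mult.assoc cis_mult left_diff_distrib)
    qed
    show "?t m integrable_on {0..2*pi}"
      unfolding eq by (intro integrable_add integrable_on_mult_right ints)
    have "?I m = a m / sqrt (2*pi) * (if int m - int n = 0 then 2 * pi else 0)
        + cnj (a m) / sqrt (2*pi) * (if - int m - int n = 0 then 2 * pi else 0)"
      unfolding eq
      by (subst Henstock_Kurzweil_Integration.integral_add)
         (auto simp only: integrable_on_mult_right ints Henstock_Kurzweil_Integration.integral_mult_right integral_cis)
    moreover have "complex_of_real (2 * pi) / sqrt (2 * pi) = sqrt (2 * pi)"
      by (metis of_real_divide real_div_sqrt pi_ge_zero mult_nonneg_nonneg zero_le_numeral)
    ultimately show "?I m = (if m = n then sqrt (2 * pi) * a n else 0)"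
      using a0 by (auto simp: field_simps split: if_splits)
  qed
  have "uniform_limit {0..2*pi} (\<lambda>N \<theta>. \<Sum>m<N. ?t m \<theta>) (\<lambda>\<theta>. complex_of_real (trig_series a \<theta>) * ?e \<theta>) sequentially"
  proof -
    have "uniform_limit {0..2*pi} (\<lambda>N \<theta>. \<Sum>m<N. ?t m \<theta>) (\<lambda>\<theta>. \<Sum>m. ?t m \<theta>) sequentially"
    proof (rule Weierstrass_m_test[where M = "\<lambda>m. 2 * norm (a m)"])
      show "norm (?t m \<theta>) \<le> 2 * norm (a m)" for m \<theta>
        using trig_term_bound[of "a m" "real m * \<theta>"]
        by (simp only: norm_mult[of _ "cis _"] norm_of_real norm_cis mult_1_right real_norm_def)
      show "summable (\<lambda>m. 2 * norm (a m))"
        by (rule summable_mult[OF rapid_summable[OF a]])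
    qed
    moreover have "(\<Sum>m. ?t m \<theta>) = complex_of_real (trig_series a \<theta>) * ?e \<theta>" for \<theta>
    proof -
      have "summable (\<lambda>m. 2 * Re (a m * cis (real m * \<theta>)) / sqrt (2 * pi))"
        by (rule trig_term_summable[OF a])
      then show ?thesis unfolding trig_series_def
        by (subst suminf_mult2[symmetric]) (auto simp: summable_of_real suminf_of_real simp del: of_real_divide of_real_mult)
    qed
    ultimately show ?thesis by simp
  qed
  then obtain I J where I: "\<And>N. ((\<lambda>\<theta>. \<Sum>m<N. ?t m \<theta>) has_integral I N) {0..2*pi}"
    and J: "((\<lambda>\<theta>. complex_of_real (trig_series a \<theta>) * ?e \<theta>) has_integral J) {0..2*pi}" and IJ: "I \<longlonglongrightarrow> J"
    by (rule uniform_limit_integral)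
       (auto simp: cis_conv_exp intro!: continuous_intros)
  have "I N = (\<Sum>m<N. ?I m)" for N
    using I[of N] has_integral_sum[OF finite_lessThan, of N ?t ?I "{0..2*pi}"] intt
    by (metis (no_types, lifting) has_integral_unique integrable_integral)
  then have "I N = (\<Sum>m<N. if m = n then sqrt (2 * pi) * a n else 0)" for N
    by (simp only: tm)
  then have "\<forall>\<^sub>F N in sequentially. I N = sqrt (2 * pi) * a n"
    unfolding eventually_sequentially by (intro exI[of _ "Suc n"]) (auto simp: sum.delta)
  then have "I \<longlonglongrightarrow> sqrt (2 * pi) * a n" by (simp add: tendsto_eventually)
  then have "J = sqrt (2 * pi) * a n" using IJ LIMSEQ_unique by blast
  then show ?thesis using J unfolding fourier_def by (simp add: integral_unique)
qed


lemma fourier_0: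
  assumes "continuous_on UNIV f"
  shows "fourier f 0 = complex_of_real (integral {0..2 * pi} f) / sqrt (2 * pi)"
proof -
  have "f integrable_on {0..2*pi}"
    by (rule integrable_continuous_real) (rule continuous_on_subset[OF assms], simp)
  then have "integral {0..2*pi} (complex_of_real \<circ> f) = complex_of_real (integral {0..2*pi} f)"
    by (rule integral_linear[OF _ bounded_linear_of_real])
  then show ?thesis unfolding fourier_def by (simp add: o_def)
qed

lemma trig_series_zero_mean:
  assumes "rapid a" "a 0 = 0"
  shows "integral {0..2 * pi} (trig_series a) = 0"
  using fourier_trig_series[OF assms, of 0] fourier_0[OF smooth_continuous_on[OF trig_series_smooth[OF assms(1)]]]
    assms(2) by simp

lemma trig_series_periodic: "trig_series a (\<theta> + 2 * pi) = trig_series a \<theta>"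
proof -
  have "cis (real m * (\<theta> + 2 * pi)) = cis (real m * \<theta>)" for m
    using cis_2pi_int[of "real m * \<theta>" "int m"] by (simp add: distrib_left)
  then show ?thesis unfolding trig_series_def by (simp only:)
qed

lemma trig_series_add:
  assumes "rapid a" "rapid b"
  shows "trig_series (\<lambda>m. a m + b m) \<theta> = trig_series a \<theta> + trig_series b \<theta>"
  unfolding trig_series_def
  by (subst suminf_add[OF trig_term_summable[OF assms(1)] trig_term_summable[OF assms(2)]])
     (rule suminf_cong, simp only: distrib_right plus_complex.sel distrib_left add_divide_distrib)

lemma trig_series_scale:
  assumes "rapid a"
  shows "trig_series (\<lambda>m. complex_of_real r * a m) \<theta> = r * trig_series a \<theta>"
  unfolding trig_series_def
  by (subst suminf_mult[symmetric, OF trig_term_summable[OF assms]])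
     (rule suminf_cong, simp add: algebra_simps)

definition coeff :: "circle_fun \<Rightarrow> int \<Rightarrow> complex" where
  "coeff f = fourier (apply_cf f)"

lemma apply_cf:
  "smooth (apply_cf f)" "apply_cf f (x + 2 * pi) = apply_cf f x" "integral {0..2 * pi} (apply_cf f) = 0"
  using apply_cf[of f] by auto

lemma coeff_0: "coeff f 0 = 0"
  unfolding coeff_def by (simp add: fourier_0 smooth_continuous_on apply_cf)

lemma coeff_add: "coeff (f + g) n = coeff f n + coeff g n"
  unfolding coeff_def plus_circle_fun.rep_eq by (simp add: fourier_add smooth_continuous_on apply_cf)

lemma coeff_scaleR: "coeff (r *\<^sub>R f) n = r * coeff f n"
  unfolding coeff_def scaleR_circle_fun.rep_eq by (simp add: fourier_scale)

lemma coeff_shift: "coeff (shift a f) n = cis (of_int n * a) * coeff f n"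
  unfolding coeff_def shift.rep_eq by (simp add: fourier_shift smooth_continuous_on apply_cf)

lemma rapid_coeff: "rapid (\<lambda>m. coeff f (int m))"
proof (rule rapid_I)
  fix k
  obtain C where "\<And>n. \<bar>of_int n\<bar> ^ k * norm (fourier (apply_cf f) n) \<le> C"
    using fourier_decay[of "apply_cf f" k] apply_cf by blast
  from this[of "int _"] show "\<exists>C. \<forall>m. real m ^ k * norm (coeff f (int m)) \<le> C"
    unfolding coeff_def by auto
qed

text \<open>The real operator multiplying the Fourier coefficients with index \<open>n\<close> by \<open>c \<bar>n\<bar>\<close>: the terms
  with index \<open>m\<close> and \<open>-m\<close> of the Fourier series are complex conjugate and sum to twice the real part.\<close>

definition fourier_mult :: "(nat \<Rightarrow> real) \<Rightarrow> circle_fun \<Rightarrow> circle_fun" where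
  "fourier_mult c f = Abs_cf (\<lambda>\<theta>. \<Sum>m. 2 * Re (complex_of_real (c m) * coeff f (int m) * cis (real m * \<theta>)) / sqrt (2 * pi))"

context
  fixes c :: "nat \<Rightarrow> real"
  assumes c: "\<And>m. \<bar>c m\<bar> \<le> real m"
begin

lemma rapid_mult_coeff: "rapid (\<lambda>m. complex_of_real (c m) * coeff f (int m))"
  by (rule rapid_mult[OF rapid_coeff, where d = 1]) (simp add: c)

lemma apply_fourier_mult:
  "apply_cf (fourier_mult c f) = trig_series (\<lambda>m. complex_of_real (c m) * coeff f (int m))"
  unfolding fourier_mult_def trig_series_def[symmetric]
  by (rule Abs_cf_inverse)
     (auto intro!: trig_series_smooth trig_series_periodic trig_series_zero_mean rapid_mult_coeff simp: coeff_0)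

lemma coeff_fourier_mult: "coeff (fourier_mult c f) (int m) = c m * coeff f (int m)"
  unfolding coeff_def[of "fourier_mult c f"] apply_fourier_mult
  by (subst fourier_trig_series) (auto intro: rapid_mult_coeff simp: coeff_0)

lemma linear_fourier_mult: "linear (fourier_mult c)"
proof (rule linearI)
  fix f g
  show "fourier_mult c (f + g) = fourier_mult c f + fourier_mult c g"
    by (rule apply_cf_inject[THEN iffD1], rule ext)
       (simp add: apply_fourier_mult plus_circle_fun.rep_eq coeff_add distrib_left trig_series_add rapid_mult_coeff)
next
  fix r f
  show "fourier_mult c (r *\<^sub>R f) = r *\<^sub>R fourier_mult c f"
    by (rule apply_cf_inject[THEN iffD1], rule ext)
       (simp add: apply_fourier_mult scaleR_circle_fun.rep_eq coeff_scaleR mult.left_commute[of "complex_of_real (c _)"]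
          trig_series_scale rapid_mult_coeff)
qed

end

section \<open>Phase space\<close>

type_synonym phase = "circle_fun \<times> circle_fun"

text \<open>An element of type \<open>phase\<close> is a pair \<open>(\<xi>, P)\<close>.\<close>

definition \<Omega> :: "phase \<Rightarrow> phase \<Rightarrow> real" where
  "\<Omega> x y = integral {0..2 * pi}
     (\<lambda>\<theta>. apply_cf (fst y) \<theta> * apply_cf (snd x) \<theta> - apply_cf (fst x) \<theta> * apply_cf (snd y) \<theta>)"

definition symplectic :: "(phase \<Rightarrow> phase) \<Rightarrow> bool" where
  "symplectic A \<longleftrightarrow> linear A \<and> bij A \<and> (\<forall>x y. \<Omega> (A x) (A y) = \<Omega> x y)"

text \<open>For \<open>m \<ge> 1\<close>, \<open>mode m\<close> is the mode with index \<open>m\<close> and \<open>mode_neg_cnj m\<close> is the complex conjugate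
  of the mode with index \<open>-m\<close>. The value at \<open>m = 0\<close> is irrelevant.\<close>

definition mode :: "nat \<Rightarrow> phase \<Rightarrow> complex" where
  "mode m x = (m * coeff (fst x) (int m) + \<i> * coeff (snd x) (int m)) / sqrt (2 * real m)"

definition mode_neg_cnj :: "nat \<Rightarrow> phase \<Rightarrow> complex" where
  "mode_neg_cnj m x = (m * coeff (fst x) (int m) - \<i> * coeff (snd x) (int m)) / sqrt (2 * real m)"

definition modes :: "nat \<Rightarrow> phase \<Rightarrow> complex ^ 4" where
  "modes m x = vector [mode m x, mode_neg_cnj m x, cnj (mode_neg_cnj m x), cnj (mode m x)]"

definition block_diagonal :: "(phase \<Rightarrow> phase) \<Rightarrow> (nat \<Rightarrow> complex ^ 4 ^ 4) \<Rightarrow> bool" where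
  "block_diagonal A M \<longleftrightarrow> (\<forall>m\<ge>1. \<forall>x. modes m (A x) = M m *v modes m x)"

definition diag4 :: "complex \<Rightarrow> complex \<Rightarrow> complex \<Rightarrow> complex \<Rightarrow> complex ^ 4 ^ 4" where
  "diag4 p q r s = vector [vector [p, 0, 0, 0], vector [0, q, 0, 0], vector [0, 0, r, 0], vector [0, 0, 0, s]]"

definition bogoliubov :: "complex \<Rightarrow> complex \<Rightarrow> complex ^ 4 ^ 4" where
  "bogoliubov a b = vector
     [vector [a,     b,     0,     0    ],
      vector [cnj b, cnj a, 0,     0    ],
      vector [0,     0,     a,     b    ],
      vector [0,     0,     cnj b, cnj a]]"

lemma vector_4 [simp]:
  "(vector [x, y, z, w] :: 'a::zero ^ 4) $ 1 = x"
  "(vector [x, y, z, w] :: 'a::zero ^ 4) $ 2 = y"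
  "(vector [x, y, z, w] :: 'a::zero ^ 4) $ 3 = z"
  "(vector [x, y, z, w] :: 'a::zero ^ 4) $ 4 = w"
  unfolding vector_def by simp_all

lemma diag4_mult: "diag4 p q r s *v vector [x, y, z, w] = vector [p * x, q * y, r * z, s * w]"
  by (simp add: vec_eq_iff forall_4 matrix_vector_mult_def sum_4 diag4_def)

lemma bogoliubov_mult:
  "bogoliubov a b *v vector [x, y, z, w] =
     vector [a * x + b * y, cnj b * x + cnj a * y, a * z + b * w, cnj b * z + cnj a * w]"
  by (simp add: vec_eq_iff forall_4 matrix_vector_mult_def sum_4 bogoliubov_def)

section \<open>Translations and complex structures\<close>

definition translation :: "real \<Rightarrow> phase \<Rightarrow> phase" where
  "translation \<alpha> = map_prod (shift \<alpha>) (shift \<alpha>)"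

lemma block_diagonal_translation:
  "block_diagonal (translation \<alpha>) (\<lambda>m. diag4 (exp (\<i> * m * \<alpha>)) (exp (\<i> * m * \<alpha>)) (exp (- \<i> * m * \<alpha>)) (exp (- \<i> * m * \<alpha>)))"
proof -
  have "exp (\<i> * m * \<alpha>) = cis (m * \<alpha>)" "exp (- \<i> * m * \<alpha>) = cnj (cis (m * \<alpha>))" for m :: nat
    by (simp_all add: cis_conv_exp mult.assoc exp_cnj)
  moreover have "mode m (translation \<alpha> x) = cis (m * \<alpha>) * mode m x"
    "mode_neg_cnj m (translation \<alpha> x) = cis (m * \<alpha>) * mode_neg_cnj m x" for m x
    by (simp_all add: mode_def mode_neg_cnj_def translation_def coeff_shift algebra_simps)
  ultimately show ?thesis
    by (simp add: block_diagonal_def modes_def diag4_mult)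
qed

definition translation_invariant :: "(phase \<Rightarrow> phase) \<Rightarrow> bool" where
  "translation_invariant J \<longleftrightarrow> (\<forall>\<alpha>. inv (translation \<alpha>) \<circ> J \<circ> translation \<alpha> = J)"

definition compatible_complex_structure :: "(phase \<Rightarrow> phase) \<Rightarrow> bool" where
  "compatible_complex_structure J \<longleftrightarrow>
     linear J \<and> (\<forall>x. J (J x) = - x) \<and> symplectic J \<and> (\<forall>x. x \<noteq> 0 \<longrightarrow> \<Omega> (J x) x > 0)"

text \<open>Written in terms of \<open>\<xi>\<close> and \<open>P\<close>, the structure with blocks \<open>diag(i, -i, i, -i)\<close> sends the Fourier
  coefficients \<open>(\<xi>\<^sub>m, P\<^sub>m)\<close> to \<open>(- P\<^sub>m / m, m \<xi>\<^sub>m)\<close>; see \<open>block_diagonal_J0\<close> below.\<close>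

definition J\<^sub>0 :: "phase \<Rightarrow> phase" where
  "J\<^sub>0 x = (fourier_mult (\<lambda>m. - 1 / real m) (snd x), fourier_mult real (fst x))"

lemma inverse_nat_bound: "\<bar>- 1 / real m\<bar> \<le> real m"
proof (cases "m = 0")
  case False
  then have "1 * 1 \<le> real m * real m" by (intro mult_mono) auto
  with False show ?thesis by (simp add: field_simps)
qed simp

lemma linear_J0: "linear J\<^sub>0"
  using linear_fourier_mult[of "\<lambda>m. - 1 / real m", OF inverse_nat_bound] linear_fourier_mult[of real]
  by (intro linearI) (simp_all add: J\<^sub>0_def linear_add linear_scale)

lemma block_diagonal_J0: "block_diagonal J\<^sub>0 (\<lambda>m. diag4 \<i> (- \<i>) \<i> (- \<i>))"
proof -
  have "mode m (J\<^sub>0 x) = \<i> * mode m x" "mode_neg_cnj m (J\<^sub>0 x) = - \<i> * mode_neg_cnj m x" if "m \<ge> 1" for m x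
    using that
    by (simp_all add: mode_def mode_neg_cnj_def J\<^sub>0_def coeff_fourier_mult inverse_nat_bound
        coeff_fourier_mult[of "\<lambda>m. - 1 / real m", OF inverse_nat_bound, simplified] field_simps)
  then show ?thesis
    by (simp add: block_diagonal_def modes_def diag4_mult)
qed

section \<open>Unitary implementability\<close>

definition inner_J :: "(phase \<Rightarrow> phase) \<Rightarrow> phase \<Rightarrow> phase \<Rightarrow> complex" where
  "inner_J J x y = (complex_of_real (\<Omega> (J x) y) - \<i> * complex_of_real (\<Omega> x y)) / 2"

text \<open>\<open>\<iota>\<close> exhibits the real Hilbert space \<open>'h\<close> as the completion of phase space with respect to
  \<open>inner_J J\<close>. Since the type of the completion cannot depend on \<open>J\<close>, the embedding is a parameter; it is
  unique up to isometry. The operators in question are real-linear, so the completion is taken as a real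
  Hilbert space, with inner product the real part of \<open>inner_J J\<close> (which has the same norm).\<close>

definition is_completion :: "(phase \<Rightarrow> phase) \<Rightarrow> (phase \<Rightarrow> 'h::{real_inner, complete_space}) \<Rightarrow> bool" where
  "is_completion J \<iota> \<longleftrightarrow> linear \<iota> \<and> (\<forall>x y. \<iota> x \<bullet> \<iota> y = Re (inner_J J x y)) \<and> closure (range \<iota>) = UNIV"

definition orthonormal_basis :: "'h::real_inner set \<Rightarrow> bool" where
  "orthonormal_basis B \<longleftrightarrow> (\<forall>x\<in>B. norm x = 1) \<and> pairwise orthogonal B \<and> closure (span B) = UNIV"

definition hilbert_schmidt :: "('h::{real_inner, complete_space} \<Rightarrow> 'h) \<Rightarrow> bool" where
  "hilbert_schmidt T \<longleftrightarrow> bounded_linear T \<and> (\<exists>B. orthonormal_basis B \<and> (\<lambda>e. (norm (T e))\<^sup>2) summable_on B)"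

definition extends_to_hilbert_schmidt :: "(phase \<Rightarrow> 'h::{real_inner, complete_space}) \<Rightarrow> (phase \<Rightarrow> phase) \<Rightarrow> bool" where
  "extends_to_hilbert_schmidt \<iota> A \<longleftrightarrow> (\<exists>T. hilbert_schmidt T \<and> (\<forall>x. T (\<iota> x) = \<iota> (A x)))"

definition unitarily_implementable ::
  "(phase \<Rightarrow> phase) \<Rightarrow> (phase \<Rightarrow> 'h::{real_inner, complete_space}) \<Rightarrow> (phase \<Rightarrow> phase) \<Rightarrow> bool" where
  "unitarily_implementable J \<iota> A \<longleftrightarrow> extends_to_hilbert_schmidt \<iota> (\<lambda>x. (1 / 2) *\<^sub>R (A x + J (A (J x))))"

end

theory Submission
  imports Defs
begin

text \<open>Conjugation by \<open>K\<close> turns implementability of \<open>U\<close> with respect to \<open>J\<close> into implementability of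
  \<open>K\<^sup>-\<^sup>1 U K\<close> with respect to \<open>J\<^sub>0\<close>, so the second Bogoliubov coefficients of \<open>U\<close> and of \<open>K\<^sup>-\<^sup>1 U K\<close>
  are both square summable. Solving the formula for the latter for \<open>Im \<alpha>\<^sub>m\<close> shows that
  \<open>\<Sum>m. \<bar>\<lambda>\<^sub>m / \<kappa>\<^sub>m\<bar>\<^sup>2 (Im \<alpha>\<^sub>m)\<^sup>2\<close> is finite at every time. This sum is bounded uniformly in time on a set
  of measure larger than \<open>\<pi> - \<delta>\<close>; integrating over it and using \<open>(Im \<alpha>\<^sub>m)\<^sup>2 \<ge> 1 - (Re \<alpha>\<^sub>m)\<^sup>2\<close>, Condition 1
  bounds \<open>\<Sum>m. \<bar>\<lambda>\<^sub>m / \<kappa>\<^sub>m\<bar>\<^sup>2\<close>. Since \<open>\<bar>\<kappa>\<^sub>m\<bar>\<^sup>2 = 1 + \<bar>\<lambda>\<^sub>m\<bar>\<^sup>2\<close>, the sequence \<open>\<lambda>\<^sub>m\<close> tends to \<open>0\<close> and the claim follows.\<close>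

section \<open>Hilbert-Schmidt operators\<close>

lemma bessel_inequality:
  fixes g :: "'i \<Rightarrow> 'a::real_inner"
  assumes fin: "finite I"
    and on: "\<And>i j. i \<in> I \<Longrightarrow> j \<in> I \<Longrightarrow> g i \<bullet> g j = (if i = j then 1 else 0)"
  shows "(\<Sum>i\<in>I. (x \<bullet> g i)\<^sup>2) \<le> (norm x)\<^sup>2"
proof -
  define p where "p = (\<Sum>i\<in>I. (x \<bullet> g i) *\<^sub>R g i)"
  have xp: "x \<bullet> p = (\<Sum>i\<in>I. (x \<bullet> g i)\<^sup>2)"
    by (simp add: p_def inner_sum_right power2_eq_square)
  have "p \<bullet> p = (\<Sum>i\<in>I. \<Sum>j\<in>I. (x \<bullet> g j) * ((x \<bullet> g i) * (g j \<bullet> g i)))"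
    by (simp add: p_def inner_sum_right inner_sum_left sum_distrib_left mult.left_commute)
  also have "\<dots> = (\<Sum>i\<in>I. \<Sum>j\<in>I. if j = i then (x \<bullet> g i)\<^sup>2 else 0)"
    by (intro sum.cong refl) (auto simp: on power2_eq_square)
  also have "\<dots> = (\<Sum>i\<in>I. (x \<bullet> g i)\<^sup>2)"
    using fin by (simp add: sum.delta)
  finally have pp: "p \<bullet> p = (\<Sum>i\<in>I. (x \<bullet> g i)\<^sup>2)" .
  have "0 \<le> (x - p) \<bullet> (x - p)" by simp
  also have "\<dots> = x \<bullet> x - (\<Sum>i\<in>I. (x \<bullet> g i)\<^sup>2)"
    by (simp add: inner_diff_left inner_diff_right inner_commute[of p x] xp pp)
  finally show ?thesis by (simp add: power2_norm_eq_inner)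
qed

text \<open>A substitute for Parseval's identity: the inequality is Cauchy-Schwarz on the span of
  the basis, and the set of vectors satisfying it is closed.\<close>

lemma orthonormal_basis_functional_bound:
  fixes \<phi> :: "'h::real_inner \<Rightarrow> real"
  assumes B: "orthonormal_basis B" and \<phi>: "bounded_linear \<phi>"
    and sm: "(\<lambda>e. (\<phi> e)\<^sup>2) summable_on B"
  shows "(\<phi> x)\<^sup>2 \<le> (norm x)\<^sup>2 * (\<Sum>\<^sub>\<infinity>e\<in>B. (\<phi> e)\<^sup>2)"
proof -
  let ?K = "\<Sum>\<^sub>\<infinity>e\<in>B. (\<phi> e)\<^sup>2"
  let ?S = "{x. (\<phi> x)\<^sup>2 \<le> (norm x)\<^sup>2 * ?K}"
  interpret bounded_linear \<phi> by fact
  have "continuous_on UNIV \<phi>"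
    by (intro linear_continuous_on \<phi>)
  then have "closed ?S"
    by (intro closed_Collect_le continuous_intros)
  moreover have "span B \<subseteq> ?S"
  proof
    fix x assume "x \<in> span B"
    then obtain t r where t: "finite t" "t \<subseteq> B" and x: "x = (\<Sum>a\<in>t. r a *\<^sub>R a)"
      unfolding span_explicit by blast
    have on: "a \<bullet> b = (if a = b then 1 else 0)" if "a \<in> t" "b \<in> t" for a b
    proof (cases "a = b")
      case True
      then show ?thesis using B that t unfolding orthonormal_basis_def
        by (auto simp: norm_eq_1)
    next
      case False
      then show ?thesis using B that t unfolding orthonormal_basis_def pairwise_def orthogonal_def
        by (simp add: subset_eq)
    qed
    have xa: "x \<bullet> a = r a" if "a \<in> t" for a
    proof -
      have "x \<bullet> a = (\<Sum>b\<in>t. r b * (b \<bullet> a))" by (simp add: x inner_sum_left)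
      also have "\<dots> = (\<Sum>b\<in>t. if b = a then r b else 0)"
        by (intro sum.cong refl) (auto simp: on that)
      finally show ?thesis using t that by (simp add: sum.delta)
    qed
    have r: "(\<Sum>a\<in>t. (r a)\<^sup>2) \<le> (norm x)\<^sup>2"
      using bessel_inequality[of t "\<lambda>a. a" x] t on xa by simp
    have "(\<phi> x)\<^sup>2 = (\<Sum>a\<in>t. r a * \<phi> a)\<^sup>2"
      by (simp add: x sum scaleR)
    also have "\<dots> \<le> (\<Sum>a\<in>t. (r a)\<^sup>2) * (\<Sum>a\<in>t. (\<phi> a)\<^sup>2)"
      by (rule Cauchy_Schwarz_ineq_sum)
    also have "\<dots> \<le> (norm x)\<^sup>2 * ?K"
      using t by (intro mult_mono r finite_sum_le_infsum sm sum_nonneg) auto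
    finally show "x \<in> ?S" by simp
  qed
  ultimately have "closure (span B) \<subseteq> ?S" by (rule closure_minimal[rotated])
  then show ?thesis using B unfolding orthonormal_basis_def by auto
qed

lemma has_sum_finite_sum:
  fixes f :: "'i \<Rightarrow> 'e \<Rightarrow> real"
  assumes "finite I" "\<And>i. i \<in> I \<Longrightarrow> (f i has_sum s i) B"
  shows "((\<lambda>e. \<Sum>i\<in>I. f i e) has_sum (\<Sum>i\<in>I. s i)) B"
  using assms by (induction I rule: finite_induct) (auto intro!: has_sum_add)

text \<open>For each \<open>i\<close>, the functional bound applied to
  \<open>T x \<bullet> g i\<close> dominates the matrix element at \<open>f i\<close> by a sum over
  the basis. Adding over \<open>i\<close>, exchanging the sums and using Bessel for the
  \<open>g i\<close> leaves the Hilbert-Schmidt sum, which serves as \<open>C\<close>. As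
  \<open>C\<close> is uniform in \<open>I\<close>, \<open>f\<close> and \<open>g\<close>, infinite
  families of matrix elements are square summable.\<close>

lemma hilbert_schmidt_diagonal_bound:
  fixes T :: "'h::{real_inner, complete_space} \<Rightarrow> 'h"
  assumes "hilbert_schmidt T"
  obtains C where "\<And>(I :: 'i set) f g. finite I \<Longrightarrow> (\<And>i. i \<in> I \<Longrightarrow> norm (f i) = 1) \<Longrightarrow>
      (\<And>i j. i \<in> I \<Longrightarrow> j \<in> I \<Longrightarrow> g i \<bullet> g j = (if i = j then 1 else 0)) \<Longrightarrow>
      (\<Sum>i\<in>I. (T (f i) \<bullet> g i)\<^sup>2) \<le> C"
proof -
  obtain B where B: "orthonormal_basis B" and sm: "(\<lambda>e. (norm (T e))\<^sup>2) summable_on B"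
    and T: "bounded_linear T"
    using assms unfolding hilbert_schmidt_def by blast
  have "(\<Sum>i\<in>I. (T (f i) \<bullet> g i)\<^sup>2) \<le> (\<Sum>\<^sub>\<infinity>e\<in>B. (norm (T e))\<^sup>2)"
    if I: "finite I" and f: "\<And>i. i \<in> I \<Longrightarrow> norm (f i) = 1"
      and g: "\<And>i j. i \<in> I \<Longrightarrow> j \<in> I \<Longrightarrow> g i \<bullet> g j = (if i = j then 1 else 0)"
    for I :: "'i set" and f g
  proof -
    \<comment> \<open>Bessel for a one-element family is Cauchy-Schwarz against the unit vector
      \<open>g i\<close>.\<close>
    have bd: "(T e \<bullet> g i)\<^sup>2 \<le> (norm (T e))\<^sup>2" if "i \<in> I" for e i
      using bessel_inequality[of "{i}" g "T e"] g that by simp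
    have smi: "(\<lambda>e. (T e \<bullet> g i)\<^sup>2) summable_on B" if "i \<in> I" for i
      using bd that by (intro summable_on_comparison_test[OF sm]) auto
    have bl: "bounded_linear (\<lambda>x. T x \<bullet> g i)" for i
      using bounded_linear_compose[OF bounded_linear_inner_left T] by simp
    have "(T (f i) \<bullet> g i)\<^sup>2 \<le> (\<Sum>\<^sub>\<infinity>e\<in>B. (T e \<bullet> g i)\<^sup>2)" if "i \<in> I" for i
      using orthonormal_basis_functional_bound[OF B bl smi[OF that], of "f i"] f that by simp
    then have "(\<Sum>i\<in>I. (T (f i) \<bullet> g i)\<^sup>2) \<le> (\<Sum>i\<in>I. \<Sum>\<^sub>\<infinity>e\<in>B. (T e \<bullet> g i)\<^sup>2)"
      by (rule sum_mono)
    also have "\<dots> \<le> (\<Sum>\<^sub>\<infinity>e\<in>B. (norm (T e))\<^sup>2)"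
      using has_sum_finite_sum[OF I has_sum_infsum[OF smi]] has_sum_infsum[OF sm]
      by (rule has_sum_mono) (auto intro!: bessel_inequality I g)
    finally show ?thesis .
  qed
  then show ?thesis using that by blast
qed

section \<open>Single-mode phase-space vectors\<close>

text \<open>For \<open>m \<ge> 1\<close> the coefficients are \<open>a\<close> at \<open>m\<close>
  and \<open>cnj a\<close> at \<open>-m\<close>. For \<open>m = 0\<close> the mean need not vanish,
  so \<open>Abs_cf\<close> may be unspecified there.\<close>

definition single_mode_fun :: "nat \<Rightarrow> complex \<Rightarrow> circle_fun" where
  "single_mode_fun m a = Abs_cf (trig_series (\<lambda>k. if k = m then a else 0))"

lemma rapid_single: "rapid (\<lambda>k. if k = m then a else 0)"
  unfolding rapid_def
proof
  fix k
  show "summable (\<lambda>n. real n ^ k * norm (if n = m then a else 0))"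
    by (rule summable_finite[of "{m}"]) auto
qed

lemma apply_single_mode_fun:
  assumes "m \<ge> 1"
  shows "apply_cf (single_mode_fun m a) = trig_series (\<lambda>k. if k = m then a else 0)"
  unfolding single_mode_fun_def using assms
  by (intro Abs_cf_inverse)
     (auto intro!: trig_series_smooth trig_series_periodic trig_series_zero_mean rapid_single)

lemma coeff_single_mode_fun:
  assumes "m \<ge> 1"
  shows "coeff (single_mode_fun m a) (int k) = (if k = m then a else 0)"
  unfolding coeff_def apply_single_mode_fun[OF assms]
  using assms by (subst fourier_trig_series[OF rapid_single]) auto

lemma fourier_mult_single_mode_fun:
  assumes "m \<ge> 1" and c: "\<And>k. \<bar>c k\<bar> \<le> real k"
  shows "fourier_mult c (single_mode_fun m a) = single_mode_fun m (c m * a)"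
proof -
  have "(\<lambda>k. complex_of_real (c k) * (if k = m then a else 0)) = (\<lambda>k. if k = m then c m * a else 0)"
    by auto
  then have "apply_cf (fourier_mult c (single_mode_fun m a)) = apply_cf (single_mode_fun m (c m * a))"
    using assms(1) by (simp add: apply_fourier_mult[OF c] apply_single_mode_fun coeff_single_mode_fun)
  then show ?thesis by (simp add: apply_cf_inject)
qed

text \<open>Parseval with only the terms \<open>m\<close> and \<open>-m\<close> present, which are
  complex conjugate. The product of the two functions is a real-linear functional \<open>h\<close>
  of the integrand defining the coefficient of \<open>g\<close>, and \<open>h\<close> commutes with
  the integral.\<close>

lemma integral_single_mode_fun_mult:
  assumes "m \<ge> 1"
  shows "integral {0..2*pi} (\<lambda>\<theta>. apply_cf (single_mode_fun m a) \<theta> * apply_cf g \<theta>)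
    = 2 * Re (a * cnj (coeff g (int m)))"
proof -
  define h where "h = (\<lambda>z. 2 * Re (a * cnj z) / sqrt (2 * pi))"
  let ?G = "\<lambda>\<theta>. complex_of_real (apply_cf g \<theta>) * cis (- (of_int (int m) * \<theta>))"
  have h: "bounded_linear h"
    unfolding h_def
    by (intro bounded_linear_intros bounded_linear_compose[OF bounded_linear_Re]
        bounded_linear_compose[OF bounded_linear_mult_right] bounded_linear_cnj
        bounded_linear_compose[OF bounded_linear_divide] bounded_linear_const_mult)
  have "apply_cf (single_mode_fun m a) \<theta> = 2 * Re (a * cis (real m * \<theta>)) / sqrt (2 * pi)" for \<theta>
  proof -
    have "(\<lambda>k. 2 * Re ((if k = m then a else 0) * cis (real k * \<theta>)) / sqrt (2 * pi))
      sums (2 * Re (a * cis (real m * \<theta>)) / sqrt (2 * pi))"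
      using sums_single[of m "\<lambda>k. 2 * Re (a * cis (real k * \<theta>)) / sqrt (2 * pi)"]
      by (rule sums_cong[THEN iffD1, rotated]) auto
    then show ?thesis
      unfolding apply_single_mode_fun[OF assms] trig_series_def by (rule sums_unique[symmetric])
  qed
  then have "(\<lambda>\<theta>. apply_cf (single_mode_fun m a) \<theta> * apply_cf g \<theta>) = h \<circ> ?G"
    unfolding h_def by (auto simp: fun_eq_iff cis_cnj algebra_simps)
  then have "integral {0..2*pi} (\<lambda>\<theta>. apply_cf (single_mode_fun m a) \<theta> * apply_cf g \<theta>)
      = h (integral {0..2*pi} ?G)"
    using integral_linear[OF fourier_integrable[OF smooth_continuous_on[OF apply_cf(1)[of g]], of "int m"] h]
    by simp
  also have "\<dots> = 2 * Re (a * cnj (coeff g (int m)))"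
    unfolding h_def coeff_def fourier_def by simp
  finally show ?thesis .
qed

text \<open>The two Fourier coefficients solve the defining equations of \<open>mode\<close> and
  \<open>mode_neg_cnj\<close> for the prescribed values \<open>b\<close> and
  \<open>c\<close>.\<close>

definition single_mode :: "nat \<Rightarrow> complex \<Rightarrow> complex \<Rightarrow> phase" where
  "single_mode m b c = (single_mode_fun m ((b + c) / sqrt (2 * real m)),
     single_mode_fun m (- \<i> * (b - c) * real m / sqrt (2 * real m)))"

lemma mode_single_mode:
  assumes "m \<ge> 1"
  shows "mode k (single_mode m b c) = (if k = m then b else 0)"
    and "mode_neg_cnj k (single_mode m b c) = (if k = m then c else 0)"
proof -
  have "complex_of_real (sqrt (2 * real m)) * complex_of_real (sqrt (2 * real m)) = 2 * of_nat m"
    by (simp flip: of_real_mult, simp)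
  moreover have "complex_of_real (sqrt (2 * real m)) \<noteq> 0" using assms by simp
  ultimately show "mode k (single_mode m b c) = (if k = m then b else 0)"
    "mode_neg_cnj k (single_mode m b c) = (if k = m then c else 0)"
    using assms
    by (auto simp: mode_def mode_neg_cnj_def single_mode_def coeff_single_mode_fun field_simps)
qed

text \<open>\<open>J\<^sub>0\<close> keeps a vector inside its mode, so the symplectic form reduces
  to two single-mode integrals. The formula makes distinct modes orthogonal and lets a product with
  a unit vector read off a mode.\<close>

lemma inner_J0_single_mode:
  assumes m: "m \<ge> 1"
  shows "Re (inner_J J\<^sub>0 (single_mode m b c) y)
    = Re (b * cnj (mode m y)) + Re (c * cnj (mode_neg_cnj m y))"
proof -
  let ?s = "sqrt (2 * real m)"
  obtain f g where y: "y = (f, g)" by (cases y)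
  have s: "complex_of_real ?s * complex_of_real ?s = 2 * of_nat m" "complex_of_real ?s \<noteq> 0"
    using m by (simp_all flip: of_real_mult, simp_all)
  \<comment> \<open>Coefficients of the image under \<open>J\<^sub>0\<close>: the pair (\<xi>, P) at
    \<open>m\<close> goes to (-P/m, m\<xi>).\<close>
  let ?x = "- (- \<i> * (b - c) * real m / ?s) / m" and ?p = "real m * ((b + c) / ?s)"
  have J: "J\<^sub>0 (single_mode m b c) = (single_mode_fun m ?x, single_mode_fun m ?p)"
    by (simp add: J\<^sub>0_def single_mode_def fourier_mult_single_mode_fun[OF m]
        fourier_mult_single_mode_fun[OF m inverse_nat_bound, simplified])
  have int: "(\<lambda>\<theta>. apply_cf u \<theta> * apply_cf v \<theta>) integrable_on {0..2*pi}" for u v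
    by (intro integrable_continuous_real continuous_intros smooth_continuous_on apply_cf)
  have "\<Omega> (J\<^sub>0 (single_mode m b c)) y
      = integral {0..2*pi} (\<lambda>\<theta>. apply_cf (single_mode_fun m ?p) \<theta> * apply_cf f \<theta>)
      - integral {0..2*pi} (\<lambda>\<theta>. apply_cf (single_mode_fun m ?x) \<theta> * apply_cf g \<theta>)"
    unfolding \<Omega>_def J y fst_conv snd_conv
    by (subst Henstock_Kurzweil_Integration.integral_diff[OF int int, symmetric])
       (simp add: mult.commute)
  also have "\<dots> = 2 * Re (?p * cnj (coeff f (int m)) - ?x * cnj (coeff g (int m)))"
    unfolding integral_single_mode_fun_mult[OF m] by simp
  also have "?p * cnj (coeff f (int m)) - ?x * cnj (coeff g (int m))
      = b * cnj (mode m y) + c * cnj (mode_neg_cnj m y)"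
    using m s by (simp add: mode_def mode_neg_cnj_def y field_simps)
  finally show ?thesis by (simp add: inner_J_def)
qed

section \<open>Mode-wise action of linear maps and blocks\<close>

lemma mode_add: "mode m (x + y) = mode m x + mode m y"
  and mode_scaleR: "mode m (r *\<^sub>R x) = r * mode m x"
  by (simp_all add: mode_def coeff_add coeff_scaleR add_divide_distrib algebra_simps)

lemma modes_bogoliubov:
  assumes "block_diagonal A (\<lambda>m. bogoliubov (a m) (b m))" "m \<ge> 1"
  shows "mode m (A x) = a m * mode m x + b m * mode_neg_cnj m x"
    and "mode_neg_cnj m (A x) = cnj (b m) * mode m x + cnj (a m) * mode_neg_cnj m x"
proof -
  have *: "modes m (A x) = bogoliubov (a m) (b m) *v modes m x"
    using assms unfolding block_diagonal_def by blast
  show "mode m (A x) = a m * mode m x + b m * mode_neg_cnj m x"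
    using arg_cong[OF *, of "\<lambda>v. v $ 1"] by (simp add: modes_def bogoliubov_mult)
  show "mode_neg_cnj m (A x) = cnj (b m) * mode m x + cnj (a m) * mode_neg_cnj m x"
    using arg_cong[OF *, of "\<lambda>v. v $ 2"] by (simp add: modes_def bogoliubov_mult)
qed

text \<open>Two equations suffice: components 4 and 3 of \<open>modes\<close> are the conjugates of
  1 and 2, and the rows of a Bogoliubov block match this.\<close>

lemma block_diagonal_bogoliubovI:
  assumes "\<And>m x. m \<ge> 1 \<Longrightarrow> mode m (A x) = a m * mode m x + b m * mode_neg_cnj m x"
    and "\<And>m x. m \<ge> 1 \<Longrightarrow> mode_neg_cnj m (A x) = cnj (b m) * mode m x + cnj (a m) * mode_neg_cnj m x"
  shows "block_diagonal A (\<lambda>m. bogoliubov (a m) (b m))"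
  using assms by (simp add: block_diagonal_def modes_def bogoliubov_mult add.commute)

lemma modes_J0:
  assumes "m \<ge> 1"
  shows "mode m (J\<^sub>0 x) = \<i> * mode m x" "mode_neg_cnj m (J\<^sub>0 x) = - \<i> * mode_neg_cnj m x"
proof -
  have *: "modes m (J\<^sub>0 x) = diag4 \<i> (- \<i>) \<i> (- \<i>) *v modes m x"
    using block_diagonal_J0 assms unfolding block_diagonal_def by blast
  show "mode m (J\<^sub>0 x) = \<i> * mode m x"
    using arg_cong[OF *, of "\<lambda>v. v $ 1"] by (simp add: modes_def diag4_mult)
  show "mode_neg_cnj m (J\<^sub>0 x) = - \<i> * mode_neg_cnj m x"
    using arg_cong[OF *, of "\<lambda>v. v $ 2"] by (simp add: modes_def diag4_mult)
qed

section \<open>Unitary implementability in terms of Bogoliubov coefficients\<close>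

text \<open>The antilinear part of \<open>A\<close> maps the unit vector \<open>(0, 1)\<close> of mode \<open>m\<close> to \<open>(b m, 0)\<close>, so
  \<open>\<bar>b m\<bar>\<close> is its matrix element against the phase-adjusted unit vector \<open>(sgn (b m), 0)\<close>.\<close>

lemma summable_bogoliubov_beta:
  fixes \<iota> :: "phase \<Rightarrow> 'h::{real_inner, complete_space}"
  assumes compl: "is_completion J\<^sub>0 \<iota>"
    and blocks: "block_diagonal A (\<lambda>m. bogoliubov (a m) (b m))"
    and impl: "unitarily_implementable J\<^sub>0 \<iota> A"
  shows "summable (\<lambda>n. (cmod (b (Suc n)))\<^sup>2)"
proof -
  obtain T where T: "hilbert_schmidt T"
    and T\<iota>: "\<And>x. T (\<iota> x) = \<iota> ((1 / 2) *\<^sub>R (A x + J\<^sub>0 (A (J\<^sub>0 x))))"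
    using impl unfolding unitarily_implementable_def extends_to_hilbert_schmidt_def by blast
  have inner: "\<iota> x \<bullet> \<iota> y = Re (inner_J J\<^sub>0 x y)" for x y
    using compl unfolding is_completion_def by blast
  \<comment> \<open>Since \<open>sgn 0 = 0\<close>, the value 1 keeps \<open>u m\<close> a unit when
    \<open>b m\<close> vanishes.\<close>
  define u where "u = (\<lambda>m. if b m = 0 then 1 else sgn (b m))"
  have u: "u m * cnj (u m) = 1" "Re (u m * cnj (b m)) = cmod (b m)" for m
  proof -
    show "u m * cnj (u m) = 1"
      by (simp only: complex_norm_square[symmetric]) (simp add: u_def norm_sgn)
    show "Re (u m * cnj (b m)) = cmod (b m)"
    proof (cases "b m = 0")
      case False
      then have "u m * cnj (b m) = complex_of_real ((cmod (b m))\<^sup>2) / cmod (b m)"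
        by (simp only: complex_norm_square) (simp add: u_def sgn_eq)
      then have "u m * cnj (b m) = complex_of_real (cmod (b m))"
        using False by (simp add: power2_eq_square)
      then show ?thesis by simp
    qed (simp add: u_def)
  qed
  define f where "f = (\<lambda>n. \<iota> (single_mode (Suc n) 0 1))"
  define g where "g = (\<lambda>n. \<iota> (single_mode (Suc n) (u (Suc n)) 0))"
  have f: "norm (f n) = 1" for n
    by (simp add: norm_eq_1 f_def inner inner_J0_single_mode mode_single_mode)
  have g: "g i \<bullet> g j = (if i = j then 1 else 0)" for i j
    using arg_cong[OF u(1)[of "Suc i"], of Re]
    by (cases "i = j") (simp_all add: g_def inner inner_J0_single_mode mode_single_mode)
  have Tfg: "T (f n) \<bullet> g n = cmod (b (Suc n))" for n
  proof -
    let ?m = "Suc n"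
    let ?x = "single_mode ?m 0 1"
    \<comment> \<open>\<open>J\<^sub>0\<close> contributes -i before \<open>A\<close> (second slot)
      and i after it (first slot). These cancel, so both summands have mode
      \<open>b ?m\<close>.\<close>
    have "mode ?m ((1 / 2) *\<^sub>R (A ?x + J\<^sub>0 (A (J\<^sub>0 ?x)))) = b ?m"
      by (simp add: mode_add mode_scaleR modes_J0 modes_bogoliubov[OF blocks] mode_single_mode mult.commute[of "b _" \<i>])
    then show ?thesis
      unfolding f_def g_def T\<iota> inner_commute[of _ "\<iota> (single_mode _ _ _)"]
      using u(2)[of ?m] by (simp add: inner inner_J0_single_mode)
  qed
  obtain C where C: "\<And>(I :: nat set) f g. finite I \<Longrightarrow> (\<And>i. i \<in> I \<Longrightarrow> norm (f i) = 1) \<Longrightarrow>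
      (\<And>i j. i \<in> I \<Longrightarrow> j \<in> I \<Longrightarrow> g i \<bullet> g j = (if i = j then 1 else 0)) \<Longrightarrow>
      (\<Sum>i\<in>I. (T (f i) \<bullet> g i)\<^sup>2) \<le> C"
    using hilbert_schmidt_diagonal_bound[OF T] by blast
  have "(\<Sum>n<N. (cmod (b (Suc n)))\<^sup>2) \<le> C" for N
    using C[of "{..<N}" f g] f g by (simp add: Tfg)
  then show ?thesis by (intro summableI_nonneg_bounded) auto
qed

section \<open>Transport from \<open>J\<close> to \<open>J\<^sub>0\<close> by
  \<open>K\<close>\<close>

text \<open>\<open>K\<close> preserves \<Omega> and intertwines \<open>J\<^sub>0\<close> with
  \<open>J\<close>, so it is an isometry between the two inner products; being onto, it preserves
  the dense range.\<close>

lemma is_completion_conjugate: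
  assumes K: "symplectic K" and J: "J = K \<circ> J\<^sub>0 \<circ> inv K" and compl: "is_completion J \<iota>"
  shows "is_completion J\<^sub>0 (\<iota> \<circ> K)"
proof -
  have bij: "bij K" and lin: "linear K" and \<Omega>: "\<And>x y. \<Omega> (K x) (K y) = \<Omega> x y"
    using K unfolding symplectic_def by blast+
  have "J (K x) = K (J\<^sub>0 x)" for x using bij by (simp add: J bij_is_inj)
  then have "inner_J J (K x) (K y) = inner_J J\<^sub>0 x y" for x y
    by (simp add: inner_J_def \<Omega>)
  moreover have "\<iota> x \<bullet> \<iota> y = Re (inner_J J x y)" for x y
    using compl unfolding is_completion_def by blast
  ultimately have "(\<iota> \<circ> K) x \<bullet> (\<iota> \<circ> K) y = Re (inner_J J\<^sub>0 x y)" for x y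
    by (simp only: o_apply)
  moreover have "range (\<iota> \<circ> K) = range \<iota>"
    using bij by (metis bij_is_surj image_comp)
  ultimately show ?thesis
    using compl linear_compose[OF lin] unfolding is_completion_def by metis
qed

text \<open>The same operator \<open>T\<close> on the same Hilbert space is the required extension
  once phase space is embedded through \<open>\<iota> \<circ> K\<close>.\<close>

lemma unitarily_implementable_conjugate:
  assumes K: "symplectic K" and J: "J = K \<circ> J\<^sub>0 \<circ> inv K" and impl: "unitarily_implementable J \<iota> A"
  shows "unitarily_implementable J\<^sub>0 (\<iota> \<circ> K) (inv K \<circ> A \<circ> K)"
proof -
  have bij: "bij K" and lin: "linear K"
    using K unfolding symplectic_def by blast+
  obtain T where T: "hilbert_schmidt T"
    and T\<iota>: "\<And>x. T (\<iota> x) = \<iota> ((1 / 2) *\<^sub>R (A x + J (A (J x))))"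
    using impl unfolding unitarily_implementable_def extends_to_hilbert_schmidt_def by blast
  have "T (\<iota> (K z)) = \<iota> (K ((1 / 2) *\<^sub>R (inv K (A (K z)) + J\<^sub>0 (inv K (A (K (J\<^sub>0 z)))))))" for z
    unfolding T\<iota> using bij
    by (simp add: J linear_scale[OF lin] linear_add[OF lin] bij_is_inj surj_f_inv_f[OF bij_is_surj])
  then show ?thesis
    unfolding unitarily_implementable_def extends_to_hilbert_schmidt_def using T by auto
qed

text \<open>Each 2x2 block has determinant 1, so its inverse is its adjugate.\<close>

lemma block_diagonal_inv_bogoliubov:
  assumes K: "block_diagonal K (\<lambda>m. bogoliubov (\<kappa> m) (\<Lambda> m))" and bij: "bij K"
    and norm: "\<And>m. m \<ge> 1 \<Longrightarrow> (cmod (\<kappa> m))\<^sup>2 - (cmod (\<Lambda> m))\<^sup>2 = 1"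
  shows "block_diagonal (inv K) (\<lambda>m. bogoliubov (cnj (\<kappa> m)) (- \<Lambda> m))"
proof (rule block_diagonal_bogoliubovI)
  fix m :: nat and x assume m: "m \<ge> 1"
  have det: "\<kappa> m * cnj (\<kappa> m) - \<Lambda> m * cnj (\<Lambda> m) = 1"
    using arg_cong[OF norm[OF m], of complex_of_real]
    by (simp only: of_real_diff complex_norm_square of_real_1)
  have K': "K (inv K x) = x" using bij by (simp add: bij_is_surj surj_f_inv_f)
  note eq = modes_bogoliubov[OF K m, of "inv K x", unfolded K']
  show "mode m (inv K x) = cnj (\<kappa> m) * mode m x + - \<Lambda> m * mode_neg_cnj m x"
    unfolding eq using det by algebra
  show "mode_neg_cnj m (inv K x) = cnj (- \<Lambda> m) * mode m x + cnj (cnj (\<kappa> m)) * mode_neg_cnj m x"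
    unfolding eq complex_cnj_minus complex_cnj_cnj using det by algebra
qed

text \<open>The product of three blocks, left unsimplified. Its second coefficient equals 2i Im(a)
  cnj(\<kappa>) \<Lambda> + cnj(\<kappa>)^2 b - \<Lambda>^2 cnj(b).\<close>

lemma block_diagonal_conjugate_bogoliubov:
  assumes K: "block_diagonal K (\<lambda>m. bogoliubov (\<kappa> m) (\<Lambda> m))" and bij: "bij K"
    and norm: "\<And>m. m \<ge> 1 \<Longrightarrow> (cmod (\<kappa> m))\<^sup>2 - (cmod (\<Lambda> m))\<^sup>2 = 1"
    and A: "block_diagonal A (\<lambda>m. bogoliubov (a m) (b m))"
  shows "block_diagonal (inv K \<circ> A \<circ> K) (\<lambda>m. bogoliubov
    (cnj (\<kappa> m) * (a m * \<kappa> m + b m * cnj (\<Lambda> m)) - \<Lambda> m * (cnj (b m) * \<kappa> m + cnj (a m) * cnj (\<Lambda> m)))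
    (cnj (\<kappa> m) * (a m * \<Lambda> m + b m * cnj (\<kappa> m)) - \<Lambda> m * (cnj (b m) * \<Lambda> m + cnj (a m) * cnj (\<kappa> m))))"
  by (rule block_diagonal_bogoliubovI)
     (simp_all add: modes_bogoliubov[OF block_diagonal_inv_bogoliubov[OF K bij norm]]
        modes_bogoliubov[OF A] modes_bogoliubov[OF K] algebra_simps)

text \<open>Division by \<open>(\<kappa>\<^sup>*)\<^sup>2\<close> isolates \<open>Im a\<close>, because \<open>\<bar>\<kappa>\<bar> \<ge> 1\<close> and \<open>\<bar>\<lambda> / \<kappa>\<bar> \<le> 1\<close>.\<close>

lemma conjugate_beta_bound:
  fixes a b \<kappa> \<Lambda> :: complex
  assumes norm: "(cmod \<kappa>)\<^sup>2 - (cmod \<Lambda>)\<^sup>2 = 1"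
  defines "c \<equiv> cnj \<kappa> * (a * \<Lambda> + b * cnj \<kappa>) - \<Lambda> * (cnj b * \<Lambda> + cnj a * cnj \<kappa>)"
  shows "(cmod \<Lambda> / cmod \<kappa>)\<^sup>2 * (Im a)\<^sup>2 \<le> (cmod c)\<^sup>2 + 2 * (cmod b)\<^sup>2"
proof -
  have k1: "cmod \<kappa> \<ge> 1"
    using norm by (smt (verit) one_le_power power2_le_imp_le norm_ge_zero power_one zero_le_power2)
  have lk: "cmod \<Lambda> \<le> cmod \<kappa>"
    using norm by (smt (verit) power2_le_imp_le norm_ge_zero)
  have "a - cnj a = 2 * \<i> * Im a"
    by (simp add: complex_eq_iff)
  then have "(2 * \<i> * Im a) * (cnj \<kappa> * \<Lambda>) = c - (cnj \<kappa>)\<^sup>2 * b + \<Lambda>\<^sup>2 * cnj b"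
    unfolding c_def by algebra
  then have "2 * \<bar>Im a\<bar> * (cmod \<kappa> * cmod \<Lambda>) = cmod (c - (cnj \<kappa>)\<^sup>2 * b + \<Lambda>\<^sup>2 * cnj b)"
    by (metis (no_types, lifting) norm_mult norm_of_real norm_ii complex_mod_cnj norm_numeral mult_1_right)
  also have "\<dots> \<le> cmod c + (cmod \<kappa>)\<^sup>2 * cmod b + (cmod \<Lambda>)\<^sup>2 * cmod b"
    by (smt (verit) norm_triangle_ineq norm_triangle_ineq4 norm_mult norm_power complex_mod_cnj)
  also have "\<dots> \<le> (cmod \<kappa>)\<^sup>2 * (cmod c + 2 * cmod b)"
  proof -
    have "cmod c \<le> (cmod \<kappa>)\<^sup>2 * cmod c"
      using k1 by (simp add: mult_le_cancel_right1)
    moreover have "(cmod \<Lambda>)\<^sup>2 * cmod b \<le> (cmod \<kappa>)\<^sup>2 * cmod b"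
      using lk by (intro mult_right_mono power_mono) auto
    ultimately show ?thesis by (simp add: algebra_simps)
  qed
  also have "2 * \<bar>Im a\<bar> * (cmod \<kappa> * cmod \<Lambda>) = (cmod \<kappa>)\<^sup>2 * (2 * \<bar>Im a\<bar> * (cmod \<Lambda> / cmod \<kappa>))"
    using k1 by (simp add: power2_eq_square)
  finally have "2 * \<bar>Im a\<bar> * (cmod \<Lambda> / cmod \<kappa>) \<le> cmod c + 2 * cmod b"
    by (rule mult_left_le_imp_le) (use k1 in auto)
  then have "(2 * \<bar>Im a\<bar> * (cmod \<Lambda> / cmod \<kappa>))\<^sup>2 \<le> (cmod c + 2 * cmod b)\<^sup>2"
    by (intro power_mono) auto
  \<comment> \<open>(x + y)^2 \<le> 2x^2 + 2y^2 with y = 2|b|.\<close>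
  also have "\<dots> \<le> 2 * (cmod c)\<^sup>2 + 8 * (cmod b)\<^sup>2"
    using sum_squares_ge_zero[of "cmod c - 2 * cmod b" 0]
    by (simp add: power2_eq_square algebra_simps)
  also have "(2 * \<bar>Im a\<bar> * (cmod \<Lambda> / cmod \<kappa>))\<^sup>2 = 4 * ((cmod \<Lambda> / cmod \<kappa>)\<^sup>2 * (Im a)\<^sup>2)"
    by (simp only: power_mult_distrib power2_abs) simp
  finally have "4 * ((cmod \<Lambda> / cmod \<kappa>)\<^sup>2 * (Im a)\<^sup>2) \<le> 2 * (cmod c)\<^sup>2 + 8 * (cmod b)\<^sup>2" .
  \<comment> \<open>Dividing by 4 leaves |c|^2/2, which is rounded up to |c|^2.\<close>
  moreover have "(cmod c)\<^sup>2 \<ge> 0" by simp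
  ultimately show ?thesis by linarith
qed

section \<open>Integration over a set of almost full measure\<close>

text \<open>\<open>S\<close> is finite everywhere, so its sublevel sets at integer levels exhaust
  the interval, and continuity from below makes their measures tend to \<open>b - a\<close>.\<close>

lemma large_sublevel_set:
  fixes S :: "real \<Rightarrow> real"
  assumes S: "S \<in> borel_measurable (lebesgue_on {a..b})" and "a \<le> b" "\<delta> > 0"
  obtains N :: real where "{x\<in>{a..b}. S x \<le> N} \<in> sets lebesgue"
    "measure lebesgue {x\<in>{a..b}. S x \<le> N} > b - a - \<delta>"
proof -
  define E where "E = (\<lambda>n::nat. {x\<in>{a..b}. S x \<le> real n})"
  have E: "E n \<in> sets lebesgue" for n
  proof -
    have "{x\<in>space (lebesgue_on {a..b}). S x \<le> real n} \<in> sets (lebesgue_on {a..b})"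
      using S by measurable
    then show ?thesis
      by (simp add: E_def sets_restrict_space_iff)
  qed
  have un: "(\<Union>n. E n) = {a..b}"
    using real_arch_simple by (auto simp: E_def)
  have "(\<lambda>n. measure lebesgue (E n)) \<longlonglongrightarrow> measure lebesgue (\<Union>n. E n)"
    by (rule Lim_measure_incseq) (use E in \<open>auto simp: un incseq_def, auto simp: E_def emeasure_lborel_Icc_eq\<close>)
  then have "(\<lambda>n. measure lebesgue (E n)) \<longlonglongrightarrow> b - a"
    using \<open>a \<le> b\<close> by (simp add: un)
  moreover have "b - a - \<delta> < b - a" using \<open>\<delta> > 0\<close> by simp
  ultimately have "\<forall>\<^sub>F n in sequentially. measure lebesgue (E n) > b - a - \<delta>"
    by (rule order_tendstoD(1))
  then obtain n where "measure lebesgue (E n) > b - a - \<delta>"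
    by (auto simp: eventually_sequentially)
  then show ?thesis using that[of "real n"] E[of n] by (simp add: E_def)
qed

text \<open>On a large sublevel set \<open>E\<close> of the series all partial sums are at most
  \<open>N\<close>. Integrating over \<open>E\<close>, where every term contributes at least
  \<open>w n * \<Delta>\<close>, bounds the partial sums of \<open>w\<close>. The role of
  \<open>p\<close> is that of 1 - (Re \<alpha>)^2 in Condition 1, and \<open>h\<close> is (Im
  \<alpha>)^2.\<close>

lemma summable_of_pointwise_summable:
  fixes w :: "nat \<Rightarrow> real" and h p :: "nat \<Rightarrow> real \<Rightarrow> real"
  assumes w: "\<And>n. w n \<ge> 0" and h: "\<And>n x. h n x \<ge> 0"
    and meas: "\<And>n. h n \<in> borel_measurable (lebesgue_on {a..b})"
    and ab: "a \<le> b" and \<delta>: "\<delta> > 0"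
    and sm: "\<And>x. x \<in> {a..b} \<Longrightarrow> summable (\<lambda>n. w n * h n x)"
    and ph: "\<And>n x. x \<in> {a..b} \<Longrightarrow> p n x \<le> h n x"
    and cond: "\<And>E. E \<in> sets lebesgue \<Longrightarrow> E \<subseteq> {a..b} \<Longrightarrow> measure lebesgue E > b - a - \<delta> \<Longrightarrow>
        \<exists>\<Delta>>0. \<forall>n. (LINT x:E|lebesgue. p n x) > \<Delta>"
  shows "summable w"
proof -
  have "(\<lambda>x. \<Sum>n. w n * h n x) \<in> borel_measurable (lebesgue_on {a..b})"
    using meas by (intro borel_measurable_suminf borel_measurable_times) auto
  then obtain N where N: "{x\<in>{a..b}. (\<Sum>n. w n * h n x) \<le> N} \<in> sets lebesgue"
    "measure lebesgue {x\<in>{a..b}. (\<Sum>n. w n * h n x) \<le> N} > b - a - \<delta>"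
    using large_sublevel_set[OF _ ab \<delta>] by blast
  define E where "E = {x\<in>{a..b}. (\<Sum>n. w n * h n x) \<le> N}"
  have E: "E \<in> sets lebesgue" "E \<subseteq> {a..b}" and Elarge: "measure lebesgue E > b - a - \<delta>"
    using N by (auto simp: E_def)
  obtain \<Delta> where \<Delta>: "\<Delta> > 0" "\<And>n. (LINT x:E|lebesgue. p n x) > \<Delta>"
    using cond[OF E Elarge] by blast
  have Efin: "emeasure lebesgue E < \<infinity>"
    using emeasure_mono[OF E(2), of lebesgue] by (simp add: le_less_trans ab)
  have intN: "set_integrable lebesgue E (\<lambda>x. N)"
    using E Efin by (simp add: set_integrable_def)
  have term_bound: "(\<Sum>n\<in>F. w n * h n x) \<le> N" if "x \<in> E" "finite F" for F x
  proof -
    have "(\<Sum>n\<in>F. w n * h n x) \<le> (\<Sum>n. w n * h n x)"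
      using that E sm w h by (intro sum_le_suminf) auto
    then show ?thesis using that by (simp add: E_def)
  qed
  have inth: "set_integrable lebesgue E (\<lambda>x. w n * h n x)" for n
  proof (rule set_integrable_bound[OF intN])
    \<comment> \<open>Measurability of \<open>h n\<close> is given on the interval only, so the
      function is extended by zero.\<close>
    have "(\<lambda>x. if x \<in> {a..b} then h n x else 0) \<in> borel_measurable lebesgue"
      using meas[of n] borel_measurable_if[of "{a..b}" "h n"] by simp
    then have "(\<lambda>x. indicator E x *\<^sub>R (w n * (if x \<in> {a..b} then h n x else 0))) \<in> borel_measurable lebesgue"
      using E(1) by measurable
    moreover have "(\<lambda>x. indicator E x *\<^sub>R (w n * (if x \<in> {a..b} then h n x else 0)))
        = (\<lambda>x. indicator E x *\<^sub>R (w n * h n x))"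
      using E(2) by (auto simp: fun_eq_iff indicator_def)
    ultimately show "set_borel_measurable lebesgue E (\<lambda>x. w n * h n x)"
      by (simp add: set_borel_measurable_def)
    show "AE x in lebesgue. x \<in> E \<longrightarrow> norm (w n * h n x) \<le> norm N"
      using term_bound[of _ "{n}"] w h by (fastforce intro: AE_I2)
  qed
  \<comment> \<open>The Bochner integral of a non-integrable function is 0 by convention, which
    contradicts the lower bound \<Delta> > 0.\<close>
  have intp: "set_integrable lebesgue E (p n)" for n
    using \<Delta>(1) \<Delta>(2)[of n] not_integrable_integral_eq[of lebesgue "\<lambda>x. indicator E x *\<^sub>R p n x"]
    unfolding set_integrable_def set_lebesgue_integral_def by force
  have le: "w n * \<Delta> \<le> (LINT x:E|lebesgue. w n * h n x)" for n
  proof -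
    have "w n * \<Delta> \<le> w n * (LINT x:E|lebesgue. p n x)"
      using \<Delta>(2)[of n] w by (intro mult_left_mono) auto
    also have "\<dots> = (LINT x:E|lebesgue. w n * p n x)" by simp
    also have "\<dots> \<le> (LINT x:E|lebesgue. w n * h n x)"
      using E(2) w ph intp by (intro set_integral_mono inth mult_left_mono) auto
    finally show ?thesis .
  qed
  have "(\<Sum>n<k. w n) \<le> (LINT x:E|lebesgue. N) / \<Delta>" for k
  proof -
    have "(\<Sum>n<k. w n) * \<Delta> \<le> (\<Sum>n<k. LINT x:E|lebesgue. w n * h n x)"
      unfolding sum_distrib_right by (intro sum_mono le)
    also have "\<dots> = (LINT x:E|lebesgue. \<Sum>n<k. w n * h n x)"
      using inth unfolding set_lebesgue_integral_def set_integrable_def scaleR_sum_right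
      by (rule Bochner_Integration.integral_sum[symmetric])
    also have "\<dots> \<le> (LINT x:E|lebesgue. N)"
    proof (rule set_integral_mono[OF _ intN term_bound])
      show "set_integrable lebesgue E (\<lambda>x. \<Sum>n<k. w n * h n x)"
        using inth unfolding set_integrable_def scaleR_sum_right
        by (rule Bochner_Integration.integrable_sum)
    qed auto
    finally show ?thesis using \<Delta>(1) by (simp add: field_simps)
  qed
  then show ?thesis by (intro summableI_nonneg_bounded w)
qed

text \<open>The ratios tend to 0, so eventually \<open>x n \<le> 1\<close>, and there
  \<open>x n\<close> is at most twice its ratio.\<close>

lemma summable_of_ratio_summable:
  fixes x :: "nat \<Rightarrow> real"
  assumes x: "\<And>n. x n \<ge> 0" and sm: "summable (\<lambda>n. x n / (1 + x n))"
  shows "summable x"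
proof (rule summable_comparison_test_ev[OF _ summable_mult[OF sm, of 2]])
  have "(\<lambda>n. x n / (1 + x n)) \<longlonglongrightarrow> 0" by (rule summable_LIMSEQ_zero[OF sm])
  then have "\<forall>\<^sub>F n in sequentially. x n / (1 + x n) < 1 / 2"
    by (rule order_tendstoD) simp
  then show "\<forall>\<^sub>F n in sequentially. norm (x n) \<le> 2 * (x n / (1 + x n))"
  proof eventually_elim
    case (elim n)
    then have "x n \<le> 1" using x[of n] by (simp add: field_simps)
    then have "x n * (1 + x n) \<le> x n * 2" using x[of n] by (intro mult_left_mono) auto
    then show ?case using x[of n] by (simp add: field_simps)
  qed
qed

section \<open>Square summability of the second coefficients of \<open>K\<close>\<close>

theorem proposition4:
  fixes U :: "real \<Rightarrow> real \<Rightarrow> phase \<Rightarrow> phase"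
    and \<alpha> \<beta> :: "nat \<Rightarrow> real \<Rightarrow> real \<Rightarrow> complex"
    and t\<^sub>0 \<delta> :: real
    and J K :: "phase \<Rightarrow> phase"
    and \<kappa> \<Lambda> :: "nat \<Rightarrow> complex"
    and \<iota>\<^sub>0 :: "phase \<Rightarrow> 'h::{real_inner, complete_space}"
    and \<iota> :: "phase \<Rightarrow> 'k::{real_inner, complete_space}"
  assumes U_symplectic: "\<And>t s. t > 0 \<Longrightarrow> s > 0 \<Longrightarrow> symplectic (U t s)"
    and U_blocks: "\<And>t s. t > 0 \<Longrightarrow> s > 0 \<Longrightarrow>
        block_diagonal (U t s) (\<lambda>m. bogoliubov (\<alpha> m t s) (\<beta> m t s))"
    and U_normalized: "\<And>m t s. m \<ge> 1 \<Longrightarrow> t > 0 \<Longrightarrow> s > 0 \<Longrightarrow>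
        (cmod (\<alpha> m t s))\<^sup>2 - (cmod (\<beta> m t s))\<^sup>2 = 1"
    and t0_pos: "t\<^sub>0 > 0"
    and delta: "0 < \<delta>" "\<delta> < pi"
    and condition_1: "\<And>E. E \<in> sets lebesgue \<Longrightarrow> E \<subseteq> {0..pi} \<Longrightarrow> measure lebesgue E > pi - \<delta> \<Longrightarrow>
        \<exists>\<Delta>>0. \<forall>m\<ge>1. (LINT \<tau>:E|lebesgue. 1 - (Re (\<alpha> m (t\<^sub>0 + \<tau>) t\<^sub>0))\<^sup>2) > \<Delta>"
    and measurable_alpha: "\<And>m. m \<ge> 1 \<Longrightarrow> (\<lambda>\<tau>. \<alpha> m (t\<^sub>0 + \<tau>) t\<^sub>0) \<in> borel_measurable (lebesgue_on {0..pi})"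
    and measurable_beta: "\<And>m. m \<ge> 1 \<Longrightarrow> (\<lambda>\<tau>. \<beta> m (t\<^sub>0 + \<tau>) t\<^sub>0) \<in> borel_measurable (lebesgue_on {0..pi})"
    and completion_J0: "is_completion J\<^sub>0 \<iota>\<^sub>0"
    and implementable_J0: "\<And>t s. t > 0 \<Longrightarrow> s > 0 \<Longrightarrow> unitarily_implementable J\<^sub>0 \<iota>\<^sub>0 (U t s)"
    and J_compatible: "compatible_complex_structure J"
    and J_invariant: "translation_invariant J"
    and completion_J: "is_completion J \<iota>"
    and implementable_J: "\<And>t s. t > 0 \<Longrightarrow> s > 0 \<Longrightarrow> unitarily_implementable J \<iota> (U t s)"
    and K_symplectic: "symplectic K"
    and J_eq: "J = K \<circ> J\<^sub>0 \<circ> inv K"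
    and K_blocks: "block_diagonal K (\<lambda>m. bogoliubov (\<kappa> m) (\<Lambda> m))"
    and K_normalized: "\<And>m. m \<ge> 1 \<Longrightarrow> (cmod (\<kappa> m))\<^sup>2 - (cmod (\<Lambda> m))\<^sup>2 = 1"
  shows "(\<lambda>m. (cmod (\<Lambda> m))\<^sup>2) summable_on {1..}"
proof -
  have bij: "bij K" using K_symplectic unfolding symplectic_def by blast
  \<comment> \<open>Modes start at 1, hence the shift by \<open>Suc\<close>.\<close>
  define w where "w = (\<lambda>n. (cmod (\<Lambda> (Suc n)) / cmod (\<kappa> (Suc n)))\<^sup>2)"
  define h where "h = (\<lambda>n \<tau>. (Im (\<alpha> (Suc n) (t\<^sub>0 + \<tau>) t\<^sub>0))\<^sup>2)"
  have "summable w"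
  proof (rule summable_of_pointwise_summable[where h = h and a = 0 and b = pi and \<delta> = \<delta>
        and p = "\<lambda>n \<tau>. 1 - (Re (\<alpha> (Suc n) (t\<^sub>0 + \<tau>) t\<^sub>0))\<^sup>2"])
    show "summable (\<lambda>n. w n * h n \<tau>)" if "\<tau> \<in> {0..pi}" for \<tau>
    proof -
      have t: "t\<^sub>0 + \<tau> > 0" using that t0_pos by simp
      note sm0 = summable_bogoliubov_beta[OF completion_J0 U_blocks[OF t t0_pos]
          implementable_J0[OF t t0_pos]]
      define \<beta>J where "\<beta>J = (\<lambda>n. let k = \<kappa> (Suc n); l = \<Lambda> (Suc n);
          a = \<alpha> (Suc n) (t\<^sub>0 + \<tau>) t\<^sub>0; b = \<beta> (Suc n) (t\<^sub>0 + \<tau>) t\<^sub>0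
        in cnj k * (a * l + b * cnj k) - l * (cnj b * l + cnj a * cnj k))"
      have smJ: "summable (\<lambda>n. (cmod (\<beta>J n))\<^sup>2)"
        unfolding \<beta>J_def Let_def
        by (rule summable_bogoliubov_beta[OF
          is_completion_conjugate[OF K_symplectic J_eq completion_J]
          block_diagonal_conjugate_bogoliubov[OF K_blocks bij K_normalized U_blocks[OF t t0_pos]]
          unitarily_implementable_conjugate[OF K_symplectic J_eq implementable_J[OF t t0_pos]]])
      show ?thesis
        using summable_add[OF smJ summable_mult[OF sm0, of 2]]
      proof (rule summable_comparison_test'[where N = 0])
        fix n
        have "norm (w n * h n \<tau>) = w n * h n \<tau>"
          by (simp add: w_def h_def)
        also have "\<dots> \<le> (cmod (\<beta>J n))\<^sup>2 + 2 * (cmod (\<beta> (Suc n) (t\<^sub>0 + \<tau>) t\<^sub>0))\<^sup>2"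
          unfolding \<beta>J_def w_def h_def Let_def
          by (rule conjugate_beta_bound[OF K_normalized]) simp
        finally show "norm (w n * h n \<tau>) \<le> (cmod (\<beta>J n))\<^sup>2 + 2 * (cmod (\<beta> (Suc n) (t\<^sub>0 + \<tau>) t\<^sub>0))\<^sup>2" .
      qed
    qed
    show "h n \<in> borel_measurable (lebesgue_on {0..pi})" for n
      unfolding h_def
      by (intro borel_measurable_power measurable_compose[OF measurable_alpha borel_measurable_Im]) simp
    \<comment> \<open>Normalization gives |\<alpha>|^2 = 1 + |\<beta>|^2 \<ge> 1.\<close>
    show "1 - (Re (\<alpha> (Suc n) (t\<^sub>0 + \<tau>) t\<^sub>0))\<^sup>2 \<le> h n \<tau>" if "\<tau> \<in> {0..pi}" for n \<tau>
      using U_normalized[of "Suc n" "t\<^sub>0 + \<tau>" t\<^sub>0] that t0_pos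
      by (simp add: h_def cmod_power2[of "\<alpha> _ _ _"]) (smt (verit) zero_le_power2)
    show "\<exists>\<Delta>>0. \<forall>n. (LINT \<tau>:E|lebesgue. 1 - (Re (\<alpha> (Suc n) (t\<^sub>0 + \<tau>) t\<^sub>0))\<^sup>2) > \<Delta>"
      if E: "E \<in> sets lebesgue" "E \<subseteq> {0..pi}" "measure lebesgue E > pi - 0 - \<delta>" for E
    proof -
      obtain \<Delta> where "\<Delta> > 0" "\<And>m. m \<ge> 1 \<Longrightarrow> (LINT \<tau>:E|lebesgue. 1 - (Re (\<alpha> m (t\<^sub>0 + \<tau>) t\<^sub>0))\<^sup>2) > \<Delta>"
        using condition_1[OF E(1,2)] E(3) unfolding diff_0_right by blast
      then show ?thesis by (intro exI[of _ \<Delta>]) simp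
    qed
    show "w n \<ge> 0" for n by (simp add: w_def)
    show "h n \<tau> \<ge> 0" for n \<tau> by (simp add: h_def)
  qed (rule pi_ge_zero delta)+
  \<comment> \<open>Here |\<kappa>|^2 = 1 + |\<Lambda>|^2 brings the weights into the form x/(1 +
    x).\<close>
  moreover have "w = (\<lambda>n. (cmod (\<Lambda> (Suc n)))\<^sup>2 / (1 + (cmod (\<Lambda> (Suc n)))\<^sup>2))"
  proof
    show "w n = (cmod (\<Lambda> (Suc n)))\<^sup>2 / (1 + (cmod (\<Lambda> (Suc n)))\<^sup>2)" for n
      using K_normalized[of "Suc n"] by (simp add: w_def power_divide algebra_simps)
  qed
  ultimately have "summable (\<lambda>n. (cmod (\<Lambda> (Suc n)))\<^sup>2)"
    using summable_of_ratio_summable[of "\<lambda>n. (cmod (\<Lambda> (Suc n)))\<^sup>2"] by simp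
  then have "((\<lambda>m. (cmod (\<Lambda> m))\<^sup>2) \<circ> Suc) summable_on UNIV"
    by (subst summable_on_UNIV_nonneg_real_iff) (simp_all add: o_def)
  then have "(\<lambda>m. (cmod (\<Lambda> m))\<^sup>2) summable_on range Suc"
    by (simp add: summable_on_reindex)
  moreover have "range Suc = {1..}" by (auto simp: image_iff Suc_le_eq gr0_conv_Suc)
  ultimately show ?thesis by simp
qed

end
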